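(* Let $T=S^1\times S^1$. There exist $\cap$-symmetric bilinear forms $B:H_1(T;\mathbb{Z})\times H_1(T;\mathbb{Z})\to\mathbb{Z}$ (i.e., $B(\beta,\gamma)-B(\gamma,\beta)=\beta\cap\gamma$ for all $\beta,\gamma$) that are not equal to $L(f)$ for any smooth embedding $f:T\to\mathbb{R}^3$.
   Context: Orientations on $T$ and on $\mathbb{R}^3$ are fixed; $\cap$ is the intersection form of $T$. For a smooth embedding $f:T\to\mathbb{R}^3$, a shift $\overline f$ of $f$ is defined by $\overline f(x)=f(x)+\varepsilon n(x)$, where $n(x)$ is a vector normal to $f(T)$ at $f(x)$ such that (the orientation of $T_xT$ pushed forward by $df$, followed by $n(x)$) agrees with the orientation of $\mathbb{R}^3$, and $\varepsilon>0$ is small. For integer 1-cycles $b,c$ on $T$, $L(f)(b,c)$ is the linking number in $\mathbb{R}^3$ of $f|_b$ and $\overline f|_c$; this gives the Seifert form $L(f)$ on $H_1(T;\mathbb{Z})$. *)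

theory Defs
  imports "HOL-Analysis.Analysis" "HOL-Analysis.Cross3"
begin

text \<open>The torus T = S^1 x S^1 is modelled as R^2 / Z^2; a map T -> R^3 is a map
  F :: real \<times> real \<Rightarrow> real^3 that is 1-periodic in both variables.
  The orientation of T is the one induced by the standard orientation of R^2
  (coordinates (u,v) in this order); R^3 carries its standard orientation.\<close>

definition pd1 :: "(real \<times> real \<Rightarrow> real^3) \<Rightarrow> real \<times> real \<Rightarrow> real^3" where
  "pd1 g = (\<lambda>(x, y). vector_derivative (\<lambda>s. g (s, y)) (at x))"

definition pd2 :: "(real \<times> real \<Rightarrow> real^3) \<Rightarrow> real \<times> real \<Rightarrow> real^3" where
  "pd2 g = (\<lambda>(x, y). vector_derivative (\<lambda>s. g (x, s)) (at y))"

fun iter_pd :: "bool list \<Rightarrow> (real \<times> real \<Rightarrow> real^3) \<Rightarrow> real \<times> real \<Rightarrow> real^3" where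
  "iter_pd [] g = g"
| "iter_pd (b # bs) g = (if b then pd1 else pd2) (iter_pd bs g)"

definition smooth_map :: "(real \<times> real \<Rightarrow> real^3) \<Rightarrow> bool" where
  "smooth_map g \<longleftrightarrow>
     (\<forall>bs. continuous_on UNIV (iter_pd bs g) \<and>
        (\<forall>x y. (\<lambda>s. iter_pd bs g (s, y)) differentiable (at x) \<and>
               (\<lambda>s. iter_pd bs g (x, s)) differentiable (at y)))"

text \<open>Smooth embedding T -> R^3: a smooth doubly 1-periodic map which is injective on
  R^2/Z^2 and an immersion (the two partial derivatives are linearly independent,
  i.e. their cross product is nonzero). Since T is compact, an injective immersion
  is an embedding.\<close>
definition smooth_torus_embedding :: "(real \<times> real \<Rightarrow> real^3) \<Rightarrow> bool" where
  "smooth_torus_embedding F \<longleftrightarrow>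
     smooth_map F \<and>
     (\<forall>x y. F (x + 1, y) = F (x, y) \<and> F (x, y + 1) = F (x, y)) \<and>
     (\<forall>x y x' y'. F (x, y) = F (x', y') \<longrightarrow> x - x' \<in> \<int> \<and> y - y' \<in> \<int>) \<and>
     (\<forall>z. cross3 (pd1 F z) (pd2 F z) \<noteq> 0)"

definition unit_normal :: "(real \<times> real \<Rightarrow> real^3) \<Rightarrow> real \<times> real \<Rightarrow> real^3" where
  "unit_normal F z = (1 / norm (cross3 (pd1 F z) (pd2 F z))) *\<^sub>R (cross3 (pd1 F z) (pd2 F z))"

definition torus_shift :: "real \<Rightarrow> (real \<times> real \<Rightarrow> real^3) \<Rightarrow> real \<times> real \<Rightarrow> real^3" where
  "torus_shift eps F z = F z + eps *\<^sub>R unit_normal F z"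

text \<open>H_1(T;Z) is identified with Z^2 via the basis given by the classes of the loops
  t \<mapsto> (t,0) and t \<mapsto> (0,t); the class (p,q) is represented by the closed curve
  t \<mapsto> (p t, q t), t \<in> [0,1].\<close>
definition torus_loop :: "int \<times> int \<Rightarrow> real \<Rightarrow> real \<times> real" where
  "torus_loop c t = (real_of_int (fst c) * t, real_of_int (snd c) * t)"

text \<open>Linking number of two disjoint closed C^1 curves [0,1] -> R^3 (Gauss integral).\<close>
definition linking_number :: "(real \<Rightarrow> real^3) \<Rightarrow> (real \<Rightarrow> real^3) \<Rightarrow> real" where
  "linking_number g h =
     (1 / (4 * pi)) *
       integral {0..1} (\<lambda>s. integral {0..1} (\<lambda>t.
         ((g s - h t) \<bullet> cross3 (vector_derivative g (at s)) (vector_derivative h (at t)))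
           / norm (g s - h t) ^ 3))"

definition is_seifert_form_of ::
    "(real \<times> real \<Rightarrow> real^3) \<Rightarrow> (int \<times> int \<Rightarrow> int \<times> int \<Rightarrow> int) \<Rightarrow> bool" where
  "is_seifert_form_of F B \<longleftrightarrow>
     (\<forall>b c. \<forall>\<^sub>F eps in at_right 0.
        linking_number (F \<circ> torus_loop b) (torus_shift eps F \<circ> torus_loop c)
          = real_of_int (B b c))"

definition torus_cap :: "int \<times> int \<Rightarrow> int \<times> int \<Rightarrow> int" where
  "torus_cap b c = snd b * fst c - fst b * snd c"

definition bilinear_int :: "(int \<times> int \<Rightarrow> int \<times> int \<Rightarrow> int) \<Rightarrow> bool" where
  "bilinear_int B \<longleftrightarrow>
     (\<forall>a b c. B (a + b) c = B a c + B b c \<and> B c (a + b) = B c a + B c b)"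

end

theory Submission
  imports Defs
begin

text \<open>
  The Seifert form of an embedded torus has determinant zero, whereas there are
  \<open>torus_cap\<close>-symmetric forms with determinant one.

  More generally, the linking matrix \<open>L\<close> of two disjoint tori \<open>F\<close> and \<open>G\<close> is singular. Let
  \<open>\<omega>\<close> be the pullback of the area form of the sphere under the direction of \<open>F x - G y\<close>. It is a closed
  2-form on the four-torus, and \<open>\<omega> \<and> \<omega> = 0\<close> pointwise because the sphere is two-dimensional. As
  \<open>\<omega>\<close> is closed, the integral of \<open>\<omega>(z + v) \<and> \<omega>(z)\<close> over \<open>z\<close> does not depend on \<open>v\<close>, hence vanishes; averaging
  over \<open>v\<close> replaces \<open>\<omega>\<close> by its periods. So \<open>det L\<close> is the product of the degree of \<open>F\<close> around a point
  of \<open>G\<close> and the degree of \<open>G\<close> around a point of \<open>F\<close>. One of them vanishes: a point of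
  maximal norm on the union of the tori lies on one of them, and it can be pushed radially to infinity
  without meeting the other one.
\<close>

section \<open>Integrals of periodic functions\<close>

definition periodic :: "('a::euclidean_space \<Rightarrow> 'b) \<Rightarrow> bool" where
  "periodic f \<longleftrightarrow> (\<forall>e\<in>Basis. \<forall>z. f (z + e) = f z)"

lemma periodic_nat: "periodic f \<Longrightarrow> e \<in> Basis \<Longrightarrow> f (z + real n *\<^sub>R e) = f z"
proof (induction n)
  case (Suc n)
  have "f (z + real (Suc n) *\<^sub>R e) = f ((z + real n *\<^sub>R e) + e)"
    by (simp add: algebra_simps)
  then show ?case using Suc by (simp add: periodic_def)
qed simp

lemma periodic_int:
  assumes "periodic f" "e \<in> Basis" shows "f (z + of_int k *\<^sub>R e) = f z"
proof (cases "k \<ge> 0")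
  case True
  then show ?thesis using periodic_nat[OF assms, of z "nat k"] by simp
next
  case False
  then show ?thesis using periodic_nat[OF assms, of "z + of_int k *\<^sub>R e" "nat (- k)"]
    by (simp add: algebra_simps)
qed

text \<open>Cutting the translated cube at the hyperplane where the \<open>e\<close>-coordinate is 1
  and moving the far slab back by \<open>e\<close> reassembles the unit cube.\<close>

lemma integral_periodic_shift_Basis:
  fixes f :: "'a::euclidean_space \<Rightarrow> real"
  assumes cont: "continuous_on UNIV f" and per: "periodic f" and e: "e \<in> Basis"
  shows "integral (cbox 0 One) (\<lambda>z. f (z + s *\<^sub>R e)) = integral (cbox 0 One) f"
proof -
  \<comment> \<open>Passing to the fractional part keeps the translated cube within two neighbouring
    unit cubes, so a single cut suffices.\<close>
  define r where "r = frac s"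
  have r: "0 \<le> r" "r \<le> 1" by (auto simp: r_def frac_ge_0 frac_lt_1 less_imp_le)
  have int: "f integrable_on cbox a b" for a b
    by (intro integrable_continuous continuous_on_subset[OF cont]) auto
  \<comment> \<open>Every box below is the unit cube with only its \<open>e\<close>-range altered.
    Isolating that coordinate turns the identities between boxes into identities between
    intervals.\<close>
  have mem: "x \<in> cbox (p *\<^sub>R e) (One + q *\<^sub>R e) \<longleftrightarrow>
      p \<le> x \<bullet> e \<and> x \<bullet> e \<le> 1 + q \<and> (\<forall>i\<in>Basis - {e}. 0 \<le> x \<bullet> i \<and> x \<bullet> i \<le> 1)" for x p q
  proof -
    have "x \<in> cbox (p *\<^sub>R e) (One + q *\<^sub>R e) \<longleftrightarrow>
       (\<forall>i\<in>insert e (Basis - {e}). (p *\<^sub>R e) \<bullet> i \<le> x \<bullet> i \<and> x \<bullet> i \<le> (One + q *\<^sub>R e) \<bullet> i)"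
      using e by (simp add: mem_box insert_absorb)
    then show ?thesis
      unfolding ball_simps using e by (auto simp: inner_Basis inner_add_left)
  qed
  note mem0 = mem[of _ 0 0, simplified]
  have "f (z + s *\<^sub>R e) = f (z + r *\<^sub>R e)" for z
    using periodic_int[OF per e, of "z + r *\<^sub>R e" "\<lfloor>s\<rfloor>"]
    by (simp add: r_def frac_def algebra_simps)
  then have "integral (cbox 0 One) (\<lambda>z. f (z + s *\<^sub>R e)) = integral (cbox 0 One) (\<lambda>z. f (z + r *\<^sub>R e))"
    by simp
  also have "\<dots> = integral (cbox (r *\<^sub>R e) (One + r *\<^sub>R e)) f"
    using integral_shift_cbox_plus[of 0 One f "r *\<^sub>R e"] by (simp add: o_def add.commute)
  also have "\<dots> = integral (cbox (r *\<^sub>R e) (One + r *\<^sub>R e) \<inter> {x. x \<bullet> e \<le> 1}) f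
      + integral (cbox (r *\<^sub>R e) (One + r *\<^sub>R e) \<inter> {x. x \<bullet> e \<ge> 1}) f"
    by (rule integral_split[OF int e])
  also have "cbox (r *\<^sub>R e) (One + r *\<^sub>R e) \<inter> {x. x \<bullet> e \<le> 1} = cbox 0 One \<inter> {x. x \<bullet> e \<ge> r}"
    using r by (auto simp only: mem mem0 Int_iff mem_Collect_eq set_eq_iff)
  also have "cbox (r *\<^sub>R e) (One + r *\<^sub>R e) \<inter> {x. x \<bullet> e \<ge> 1} = cbox (1 *\<^sub>R e) (One + r *\<^sub>R e)"
    using r by (auto simp only: mem Int_iff mem_Collect_eq set_eq_iff)
  \<comment> \<open>The far slab is the translate by \<open>e\<close> of the slab with
    \<open>e\<close>-coordinate between 0 and \<open>r\<close>.\<close>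
  also have "\<dots> = cbox (0 + e) (One + (r - 1) *\<^sub>R e + e)"
    by (simp add: scaleR_diff_left)
  also have "integral (cbox (0 + e) (One + (r - 1) *\<^sub>R e + e)) f
       = integral (cbox 0 (One + (r - 1) *\<^sub>R e)) f"
  proof -
    have "f \<circ> (+) e = f" using per e by (auto simp: periodic_def add.commute o_def)
    then show ?thesis using integral_shift_cbox_plus[of 0 "One + (r - 1) *\<^sub>R e" f e] by simp
  qed
  also have "cbox 0 (One + (r - 1) *\<^sub>R e) = cbox 0 One \<inter> {x. x \<bullet> e \<le> r}"
    using r mem[of _ 0 "r - 1"] by (auto simp: mem0 set_eq_iff)
  also have "integral (cbox 0 One \<inter> {x. x \<bullet> e \<ge> r}) f + integral (cbox 0 One \<inter> {x. x \<bullet> e \<le> r}) f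
     = integral (cbox 0 One) f"
    using integral_split[OF int e, of 0 One r] by simp
  finally show ?thesis .
qed

lemma integral_periodic_shift:
  fixes f :: "'a::euclidean_space \<Rightarrow> real"
  assumes cont: "continuous_on UNIV f" and per: "periodic f"
  shows "integral (cbox 0 One) (\<lambda>z. f (z + v)) = integral (cbox 0 One) f"
proof -
  have "integral (cbox 0 One) (\<lambda>z. f (z + (\<Sum>e\<in>A. (v \<bullet> e) *\<^sub>R e))) = integral (cbox 0 One) f"
    if "finite A" "A \<subseteq> Basis" for A
    using that
  proof (induction A rule: finite_induct)
    case (insert e A)
    let ?g = "\<lambda>z. f (z + (\<Sum>e\<in>A. (v \<bullet> e) *\<^sub>R e))"
    have "continuous_on UNIV ?g"
      by (intro continuous_on_compose2[OF cont] continuous_intros) auto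
    moreover have "periodic ?g"
      unfolding periodic_def
    proof safe
      fix b z :: 'a assume "b \<in> Basis"
      moreover have "z + b + (\<Sum>e\<in>A. (v \<bullet> e) *\<^sub>R e) = (z + (\<Sum>e\<in>A. (v \<bullet> e) *\<^sub>R e)) + b" by simp
      ultimately show "?g (z + b) = ?g z" using per unfolding periodic_def by metis
    qed
    ultimately have "integral (cbox 0 One) (\<lambda>z. ?g (z + (v \<bullet> e) *\<^sub>R e)) = integral (cbox 0 One) ?g"
      using insert.prems by (intro integral_periodic_shift_Basis) auto
    then show ?case using insert by (simp add: add.assoc)
  qed simp
  from this[of Basis] show ?thesis by (simp add: euclidean_representation)
qed

section \<open>Directional derivatives and integration by parts on the torus\<close>

definition has_dderiv ::
    "('a::real_normed_vector \<Rightarrow> 'b::real_normed_vector) \<Rightarrow> 'a \<Rightarrow> ('a \<Rightarrow> 'b) \<Rightarrow> bool" where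
  "has_dderiv f v f' \<longleftrightarrow> (\<forall>z. ((\<lambda>s. f (z + s *\<^sub>R v)) has_vector_derivative f' z) (at 0))"

lemma has_dderivD:
  assumes "has_dderiv f v f'"
  shows "((\<lambda>s. f (z + s *\<^sub>R v)) has_vector_derivative f' (z + s *\<^sub>R v)) (at s within S)"
proof -
  have "((\<lambda>r. f ((z + s *\<^sub>R v) + r *\<^sub>R v)) has_vector_derivative f' (z + s *\<^sub>R v)) (at (s - s))"
    using assms by (simp add: has_dderiv_def)
  then have "((\<lambda>r. f ((z + s *\<^sub>R v) + r *\<^sub>R v)) \<circ> (\<lambda>r. r - s) has_vector_derivative
      1 *\<^sub>R f' (z + s *\<^sub>R v)) (at s)"
    by (intro vector_diff_chain_at) (auto intro!: derivative_eq_intros)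
  then have "((\<lambda>s. f (z + s *\<^sub>R v)) has_vector_derivative f' (z + s *\<^sub>R v)) (at s)"
    by (simp add: o_def algebra_simps)
  then show ?thesis by (rule has_vector_derivative_at_within)
qed

lemma has_dderiv_shift:
  assumes "has_dderiv f v f'" shows "has_dderiv (\<lambda>z. f (z + w)) v (\<lambda>z. f' (z + w))"
proof -
  have "(\<lambda>s. f (z + s *\<^sub>R v + w)) = (\<lambda>s. f ((z + w) + s *\<^sub>R v))" for z
    by (simp add: algebra_simps)
  then show ?thesis using assms unfolding has_dderiv_def by metis
qed

lemma has_dderiv_mult:
  fixes f g :: "'a::real_normed_vector \<Rightarrow> real"
  assumes "has_dderiv f v f'" "has_dderiv g v g'"
  shows "has_dderiv (\<lambda>z. f z * g z) v (\<lambda>z. f' z * g z + f z * g' z)"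
  unfolding has_dderiv_def
proof
  fix z
  show "((\<lambda>s. f (z + s *\<^sub>R v) * g (z + s *\<^sub>R v)) has_vector_derivative f' z * g z + f z * g' z) (at 0)"
    using has_vector_derivative_mult[OF assms[unfolded has_dderiv_def, rule_format, of z]]
    by (simp add: add.commute)
qed

text \<open>The inner map \<open>g\<close> and the weight \<open>k\<close> cover three uses:
  translating over the whole torus, displacing a two-dimensional subtorus, and pairing a translated
  form with a fixed one.\<close>

lemma integral_shift_has_derivative:
  fixes f :: "'a::euclidean_space \<Rightarrow> real" and g :: "'c::euclidean_space \<Rightarrow> 'a"
  assumes d: "has_dderiv f v f'" and cont: "continuous_on UNIV f" "continuous_on UNIV f'"
    and g: "continuous_on UNIV g" and k: "continuous_on UNIV k"
  shows "((\<lambda>s. integral (cbox a b) (\<lambda>z. f (g z + s *\<^sub>R v) * k z)) has_vector_derivative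
     integral (cbox a b) (\<lambda>z. f' (g z + s *\<^sub>R v) * k z)) (at s)"
proof -
  have "((\<lambda>s. integral (cbox a b) (\<lambda>z. f (g z + s *\<^sub>R v) * k z)) has_vector_derivative
     integral (cbox a b) (\<lambda>z. f' (g z + s *\<^sub>R v) * k z)) (at s within UNIV)"
  proof (rule leibniz_rule_vector_derivative)
    show "((\<lambda>x. f (g t + x *\<^sub>R v) * k t) has_vector_derivative f' (g t + x *\<^sub>R v) * k t) (at x within UNIV)" for x t
      using has_vector_derivative_mult[OF has_dderivD[OF d, of "g t" x UNIV] has_vector_derivative_const[of "k t"]]
      by simp
    show "(\<lambda>z. f (g z + x *\<^sub>R v) * k z) integrable_on cbox a b" for x
      by (intro integrable_continuous continuous_intros continuous_on_compose2[OF cont(1)]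
          continuous_on_subset[OF k] continuous_on_compose2[OF g]) auto
    show "continuous_on (UNIV \<times> cbox a b) (\<lambda>(x, t). f' (g t + x *\<^sub>R v) * k t)"
      unfolding case_prod_beta
      by (intro continuous_intros continuous_on_compose2[OF cont(2)]
          continuous_on_compose2[OF k] continuous_on_compose2[OF g]) auto
  qed auto
  then show ?thesis by simp
qed

text \<open>The integral of the translate of \<open>f\<close> by \<open>s *\<^sub>R v\<close> is
  constant in \<open>s\<close>, while its derivative at 0 is the integral of
  \<open>f'\<close>.\<close>

lemma integral_dderiv_periodic:
  fixes f :: "'a::euclidean_space \<Rightarrow> real"
  assumes d: "has_dderiv f v f'" and cont: "continuous_on UNIV f" "continuous_on UNIV f'"
    and per: "periodic f"
  shows "integral (cbox 0 One) f' = 0"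
proof -
  have "((\<lambda>s. integral (cbox 0 One) (\<lambda>z. f (z + s *\<^sub>R v))) has_vector_derivative
     integral (cbox 0 One) f') (at 0)"
    using integral_shift_has_derivative[OF d cont, of "\<lambda>z. z" "\<lambda>_. 1" 0 One 0] by simp
  moreover have "(\<lambda>s. integral (cbox 0 One) (\<lambda>z. f (z + s *\<^sub>R v))) = (\<lambda>s. integral (cbox 0 One) f)"
    by (intro ext integral_periodic_shift cont per)
  ultimately show ?thesis
    by (metis has_vector_derivative_const vector_derivative_unique_at)
qed

lemma integral_by_parts_periodic:
  fixes f g :: "'a::euclidean_space \<Rightarrow> real"
  assumes "has_dderiv f v f'" "has_dderiv g v g'"
    and c: "continuous_on UNIV f" "continuous_on UNIV f'" "continuous_on UNIV g" "continuous_on UNIV g'"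
    and "periodic f" "periodic g"
  shows "integral (cbox 0 One) (\<lambda>z. f' z * g z) = - integral (cbox 0 One) (\<lambda>z. f z * g' z)"
proof -
  have "integral (cbox 0 One) (\<lambda>z. f' z * g z + f z * g' z) = 0"
    using assms by (intro integral_dderiv_periodic[OF has_dderiv_mult] continuous_intros)
      (auto simp: periodic_def)
  moreover have "integral (cbox 0 One) (\<lambda>z. f' z * g z + f z * g' z)
     = integral (cbox 0 One) (\<lambda>z. f' z * g z) + integral (cbox 0 One) (\<lambda>z. f z * g' z)"
    by (intro integral_add integrable_continuous continuous_intros continuous_on_subset[OF c(1)]
       continuous_on_subset[OF c(2)] continuous_on_subset[OF c(3)] continuous_on_subset[OF c(4)]) auto
  ultimately show ?thesis by simp
qed

section \<open>Closed 2-forms\<close>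

lemma const_of_zero_derivative:
  fixes f :: "real \<Rightarrow> real"
  assumes "\<And>s. (f has_vector_derivative 0) (at s)"
  shows "f s = f t"
  using assms DERIV_isconst_all[of f s t]
  by (simp add: has_real_derivative_iff_has_vector_derivative)

lemma continuous_on_UNIV_compose:
  "continuous_on UNIV f \<Longrightarrow> continuous_on S g \<Longrightarrow> continuous_on S (\<lambda>x. f (g x))"
  by (rule continuous_on_compose2[where t = UNIV]) auto

text \<open>\<open>\<omega> a b z\<close> is the value at \<open>z\<close> of a 2-form on the
  constant vector fields \<open>a\<close> and \<open>b\<close>, and \<open>\<omega>' a b c\<close>
  its derivative along \<open>c\<close>. The condition \<open>closed\<close> is the vanishing of the
  exterior derivative on three constant fields, whose brackets are zero.\<close>

locale closed_two_form =
  fixes \<omega> :: "'a \<Rightarrow> 'a \<Rightarrow> 'a::euclidean_space \<Rightarrow> real"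
    and \<omega>' :: "'a \<Rightarrow> 'a \<Rightarrow> 'a \<Rightarrow> 'a \<Rightarrow> real"
  assumes antisym: "\<omega> a b z = - \<omega> b a z"
    and cont: "continuous_on UNIV (\<omega> a b)"
    and cont': "continuous_on UNIV (\<omega>' a b c)"
    and deriv: "has_dderiv (\<omega> a b) c (\<omega>' a b c)"
    and closed: "\<omega>' a b c z + \<omega>' b c a z + \<omega>' c a b z = 0"
begin

lemma antisym': "\<omega>' a b c z = - \<omega>' b a c z"
proof -
  have "((\<lambda>s. - \<omega> b a (z + s *\<^sub>R c)) has_vector_derivative - \<omega>' b a c z) (at 0)"
    using deriv[of b a c] by (intro has_vector_derivative_minus) (auto simp: has_dderiv_def)
  moreover have "((\<lambda>s. - \<omega> b a (z + s *\<^sub>R c)) has_vector_derivative \<omega>' a b c z) (at 0)"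
    using deriv[of a b c] unfolding has_dderiv_def antisym[of b a] by simp
  ultimately show ?thesis by (metis vector_derivative_unique_at)
qed

text \<open>Stokes' theorem: when the subtorus spanned by \<open>a\<close> and \<open>b\<close>
  moves along \<open>c = z - w\<close>, closedness turns the derivative of its period into
  derivatives along \<open>a\<close> and \<open>b\<close>, which integrate to zero. Periodicity is
  asked for along \<open>a\<close> and \<open>b\<close> alone, so the lemma also serves on the
  product of a torus and a line.\<close>

lemma period_translation_invariant:
  assumes per: "\<And>p q z. \<omega> p q (z + a) = \<omega> p q z" "\<And>p q z. \<omega> p q (z + b) = \<omega> p q z"
  shows "integral (cbox 0 One) (\<lambda>x::real \<times> real. \<omega> a b (z + fst x *\<^sub>R a + snd x *\<^sub>R b))
       = integral (cbox 0 One) (\<lambda>x::real \<times> real. \<omega> a b (w + fst x *\<^sub>R a + snd x *\<^sub>R b))"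
proof -
  define g where "g = (\<lambda>x::real \<times> real. w + fst x *\<^sub>R a + snd x *\<^sub>R b)"
  define c where "c = z - w"
  have g: "continuous_on UNIV g" unfolding g_def by (intro continuous_intros)
  have "((\<lambda>s. integral (cbox 0 One) (\<lambda>x. \<omega> a b (g x + s *\<^sub>R c))) has_vector_derivative 0) (at s)" for s
  proof -
    have per': "periodic (\<lambda>x. \<omega> p q (g x + s *\<^sub>R c))" for p q
      unfolding periodic_def
    proof safe
      fix e y assume "e \<in> (Basis :: (real \<times> real) set)"
      then have "g (y + e) = g y + a \<or> g (y + e) = g y + b"
        by (auto simp: Basis_prod_def g_def algebra_simps)
      moreover have "u + a + s *\<^sub>R c = (u + s *\<^sub>R c) + a" "u + b + s *\<^sub>R c = (u + s *\<^sub>R c) + b" for u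
        by simp_all
      ultimately show "\<omega> p q (g (y + e) + s *\<^sub>R c) = \<omega> p q (g y + s *\<^sub>R c)" using per by metis
    qed
    \<comment> \<open>Coordinate derivatives on the parameter square are thereby derivatives of the
      form along \<open>a\<close> and \<open>b\<close>.\<close>
    have shift: "g (x + r *\<^sub>R (1, 0)) + s *\<^sub>R c = (g x + s *\<^sub>R c) + r *\<^sub>R a"
      "g (x + r *\<^sub>R (0, 1)) + s *\<^sub>R c = (g x + s *\<^sub>R c) + r *\<^sub>R b" for x r
      by (simp_all add: g_def algebra_simps)
    have d: "has_dderiv (\<lambda>x. \<omega> b c (g x + s *\<^sub>R c)) (1, 0) (\<lambda>x. \<omega>' b c a (g x + s *\<^sub>R c))"
      "has_dderiv (\<lambda>x. \<omega> c a (g x + s *\<^sub>R c)) (0, 1) (\<lambda>x. \<omega>' c a b (g x + s *\<^sub>R c))"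
      using deriv[of b c a] deriv[of c a b] unfolding has_dderiv_def shift by blast+
    have c': "continuous_on S (\<lambda>x. \<omega>' p q r (g x + s *\<^sub>R c))" for p q r S
      by (intro continuous_on_UNIV_compose[OF cont'] continuous_intros continuous_on_subset[OF g]) auto
    have c0: "continuous_on S (\<lambda>x. \<omega> p q (g x + s *\<^sub>R c))" for p q S
      by (intro continuous_on_UNIV_compose[OF cont] continuous_intros continuous_on_subset[OF g]) auto
    have "integral (cbox 0 One) (\<lambda>x. \<omega>' b c a (g x + s *\<^sub>R c)) = 0"
      "integral (cbox 0 One) (\<lambda>x. \<omega>' c a b (g x + s *\<^sub>R c)) = 0"
      using integral_dderiv_periodic[OF d(1) c0 c' per'] integral_dderiv_periodic[OF d(2) c0 c' per'] .
    moreover have "\<omega>' a b c y = - \<omega>' b c a y - \<omega>' c a b y" for y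
      using closed[of a b c y] by simp
    then have "integral (cbox 0 One) (\<lambda>x. \<omega>' a b c (g x + s *\<^sub>R c))
       = integral (cbox 0 One) (\<lambda>x. - \<omega>' b c a (g x + s *\<^sub>R c) - \<omega>' c a b (g x + s *\<^sub>R c))"
      by (intro integral_cong) blast
    ultimately have "integral (cbox 0 One) (\<lambda>x. \<omega>' a b c (g x + s *\<^sub>R c)) = 0"
      by (simp add: integral_diff integrable_neg integrable_continuous c' )
    then show ?thesis
      using integral_shift_has_derivative[OF deriv[of a b c] cont cont' g continuous_on_const[of UNIV 1], of 0 One s]
      by simp
  qed
  from const_of_zero_derivative[OF this, of 1 0]
  show ?thesis unfolding g_def c_def by (simp add: algebra_simps)
qed

text \<open>By Fubini, the mean over the torus is the average over all base points of the periods
  over parallel subtori, and these periods all agree.\<close>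

lemma integral_eq_period:
  assumes per: "\<And>p q. periodic (\<omega> p q)" and ab: "a \<in> Basis" "b \<in> Basis"
  shows "integral (cbox 0 One) (\<omega> a b)
       = integral (cbox 0 One) (\<lambda>x::real \<times> real. \<omega> a b (w + fst x *\<^sub>R a + snd x *\<^sub>R b))" (is "_ = ?K")
proof -
  let ?C = "cbox 0 One :: 'a set" and ?D = "cbox 0 One :: (real \<times> real) set"
  let ?g = "\<lambda>x::real \<times> real. fst x *\<^sub>R a + snd x *\<^sub>R b"
  \<comment> \<open>The unit square has area 1, so an average over it may be inserted.\<close>
  have "integral ?C (\<omega> a b) = integral ?D (\<lambda>x. integral ?C (\<omega> a b))" by simp
  also have "\<dots> = integral ?D (\<lambda>x. integral ?C (\<lambda>z. \<omega> a b (z + ?g x)))"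
    by (simp only: integral_periodic_shift[OF cont per])
  also have "\<dots> = integral ?C (\<lambda>z. integral ?D (\<lambda>x. \<omega> a b (z + ?g x)))"
    unfolding case_prod_beta
    by (intro integral_swap_continuous, unfold case_prod_beta)
       (intro continuous_on_UNIV_compose[OF cont] continuous_intros)
  also have "\<dots> = integral ?C (\<lambda>z. ?K)"
  proof (rule integral_cong)
    fix z :: 'a
    show "integral ?D (\<lambda>x. \<omega> a b (z + ?g x)) = ?K"
      using period_translation_invariant[of a b z w] per ab by (simp add: periodic_def add.assoc)
  qed
  finally show ?thesis by simp
qed

text \<open>In the derivative along \<open>v\<close>, closedness (Cartan's formula) turns the \<open>v\<close>-derivative of the
  translated form into the exterior derivative of its contraction with \<open>v\<close>; integrating by parts moves
  that derivative to the other, closed, factor.\<close>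

lemma wedge_translation_invariant:
  fixes a b c d v :: 'a
  assumes per: "\<And>p q. periodic (\<omega> p q)"
  defines "\<Phi> \<equiv> \<lambda>v. integral (cbox 0 One) (\<lambda>z. \<omega> a b (z + v) * \<omega> c d z) 
     - integral (cbox 0 One) (\<lambda>z. \<omega> a c (z + v) * \<omega> b d z)
     + integral (cbox 0 One) (\<lambda>z. \<omega> a d (z + v) * \<omega> b c z)
     + integral (cbox 0 One) (\<lambda>z. \<omega> c d (z + v) * \<omega> a b z)
     - integral (cbox 0 One) (\<lambda>z. \<omega> b d (z + v) * \<omega> a c z)
     + integral (cbox 0 One) (\<lambda>z. \<omega> b c (z + v) * \<omega> a d z)"
  shows "\<Phi> v = \<Phi> 0"
proof -
  \<comment> \<open>\<open>\<Phi> v\<close> integrates the wedge product of the form translated by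
    \<open>v\<close> with the form itself, evaluated on \<open>a\<close>, \<open>b\<close>,
    \<open>c\<close>, \<open>d\<close>; its six terms are the (2,2)-shuffles.\<close>
  have "((\<lambda>s. \<Phi> (s *\<^sub>R v)) has_vector_derivative 0) (at s)" for s
  proof -
    let ?t = "s *\<^sub>R v"
    define I where "I = (\<lambda>(f :: 'a \<Rightarrow> real) (g :: 'a \<Rightarrow> real). integral (cbox 0 One) (\<lambda>z. f (z + ?t) * g z))"
    have ct: "continuous_on S (\<lambda>z. \<omega> p q (z + ?t))" for p q S
      by (intro continuous_on_UNIV_compose[OF cont] continuous_intros)
    have ct': "continuous_on S (\<lambda>z. \<omega>' p q r (z + ?t))" for p q r S
      by (intro continuous_on_UNIV_compose[OF cont'] continuous_intros)
    have cs: "continuous_on S (\<omega> p q)" "continuous_on S (\<omega>' p q r)" for p q r S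
      using continuous_on_subset[OF cont] continuous_on_subset[OF cont'] by auto
    have pt: "periodic (\<lambda>z. \<omega> p q (z + ?t))" for p q
      using per[of p q] unfolding periodic_def by (metis add.assoc add.commute)
    have parts: "I (\<omega>' p q r) (\<omega> x y) = - I (\<omega> p q) (\<omega>' x y r)" for p q r x y
      unfolding I_def
      by (rule integral_by_parts_periodic[OF has_dderiv_shift[OF deriv] deriv ct ct' cont cont' pt per])
    have key: "I (\<omega>' p q v) (\<omega> x y) = I (\<omega> v p) (\<omega>' x y q) - I (\<omega> v q) (\<omega>' x y p)" for p q x y
    proof -
      have "I (\<omega>' p q v) (\<omega> x y) = integral (cbox 0 One) (\<lambda>z. \<omega>' v q p (z + ?t) * \<omega> x y z
           - \<omega>' v p q (z + ?t) * \<omega> x y z)"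
        unfolding I_def
      proof (rule integral_cong)
        fix z
        have "\<omega>' p q v (z + ?t) = \<omega>' v q p (z + ?t) - \<omega>' v p q (z + ?t)"
          using closed[of p q v "z + ?t"] antisym'[of q v p "z + ?t"] by simp
        from arg_cong[OF this, of "\<lambda>u. u * \<omega> x y z"]
        show "\<omega>' p q v (z + ?t) * \<omega> x y z = \<omega>' v q p (z + ?t) * \<omega> x y z
           - \<omega>' v p q (z + ?t) * \<omega> x y z" by (simp add: algebra_simps)
      qed
      also have "\<dots> = I (\<omega>' v q p) (\<omega> x y) - I (\<omega>' v p q) (\<omega> x y)"
        unfolding I_def
        by (intro integral_diff integrable_continuous continuous_intros ct' cs)
      finally show ?thesis by (simp add: parts)
    qed
    \<comment> \<open>This is closedness of the untranslated factor, with one index pair swapped so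
      that the terms match those produced by \<open>key\<close>.\<close>
    have cocycle: "I (\<omega> v u) (\<omega>' p q r) + I (\<omega> v u) (\<omega>' q r p) - I (\<omega> v u) (\<omega>' p r q) = 0" for u p q r
    proof -
      have "I (\<omega> v u) (\<omega>' p q r) + I (\<omega> v u) (\<omega>' q r p) - I (\<omega> v u) (\<omega>' p r q)
        = integral (cbox 0 One) (\<lambda>z. \<omega> v u (z + ?t) * \<omega>' p q r z + \<omega> v u (z + ?t) * \<omega>' q r p z
            - \<omega> v u (z + ?t) * \<omega>' p r q z)"
        unfolding I_def
        by (subst integral_diff integral_add; (intro integrable_continuous continuous_intros ct cs)?)+ simp
      also have "\<dots> = integral (cbox 0 One) (\<lambda>z::'a. 0)"
      proof (rule integral_cong)
        fix z
        have "\<omega>' p q r z + \<omega>' q r p z - \<omega>' p r q z = 0"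
          using closed[of p q r z] antisym'[of r p q z] by simp
        then have "\<omega> v u (z + ?t) * (\<omega>' p q r z + \<omega>' q r p z - \<omega>' p r q z) = 0" by simp
        then show "\<omega> v u (z + ?t) * \<omega>' p q r z + \<omega> v u (z + ?t) * \<omega>' q r p z
            - \<omega> v u (z + ?t) * \<omega>' p r q z = 0" by (simp add: algebra_simps)
      qed
      finally show ?thesis by simp
    qed
    have "((\<lambda>s. \<Phi> (s *\<^sub>R v)) has_vector_derivative
       (I (\<omega>' a b v) (\<omega> c d) - I (\<omega>' a c v) (\<omega> b d) + I (\<omega>' a d v) (\<omega> b c)
       + I (\<omega>' c d v) (\<omega> a b) - I (\<omega>' b d v) (\<omega> a c) + I (\<omega>' b c v) (\<omega> a d))) (at s)"
      unfolding I_def \<Phi>_def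
      by (intro has_vector_derivative_add has_vector_derivative_diff
          integral_shift_has_derivative[OF deriv cont cont' continuous_on_id cont])
    \<comment> \<open>\<open>key\<close> yields twelve terms. Grouped by the contraction
      \<open>\<omega> v u\<close> with \<open>u\<close> one of \<open>a\<close>, \<open>b\<close>,
      \<open>c\<close>, \<open>d\<close>, they form four signed instances of
      \<open>cocycle\<close>.\<close>
    moreover have "I (\<omega>' a b v) (\<omega> c d) - I (\<omega>' a c v) (\<omega> b d) + I (\<omega>' a d v) (\<omega> b c)
       + I (\<omega>' c d v) (\<omega> a b) - I (\<omega>' b d v) (\<omega> a c) + I (\<omega>' b c v) (\<omega> a d) = 0"
      using cocycle[of a b c d] cocycle[of b a c d] cocycle[of c a b d] cocycle[of d a b c]
      unfolding key by linarith
    ultimately show ?thesis by simp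
  qed
  from const_of_zero_derivative[OF this, of 1 0] show ?thesis by simp
qed

text \<open>The pointwise relation makes the wedge integral vanish without translation, hence for
  every translation. Averaging over the translation factors each term into a product of means; the
  six products coincide in pairs, giving twice the claim.\<close>

lemma periods_pluecker:
  assumes per: "\<And>p q. periodic (\<omega> p q)"
    and sq: "\<And>z. \<omega> a b z * \<omega> c d z - \<omega> a c z * \<omega> b d z + \<omega> a d z * \<omega> b c z = 0"
  defines "J \<equiv> \<lambda>p q. integral (cbox 0 One) (\<omega> p q)"
  shows "J a b * J c d - J a c * J b d + J a d * J b c = 0"
proof -
  let ?C = "cbox 0 One :: 'a set"
  define \<Psi> where "\<Psi> = (\<lambda>p q x y v. integral ?C (\<lambda>z. \<omega> p q (z + v) * \<omega> x y z))"
  have cs: "continuous_on S (\<omega> p q)" for p q S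
    using continuous_on_subset[OF cont] by auto
  have ct: "continuous_on S (\<lambda>x. \<omega> p q (f x + g x))" if "continuous_on S f" "continuous_on S g" for p q S f g
    using that by (intro continuous_on_UNIV_compose[OF cont] continuous_intros)
  have "\<Psi> a b c d 0 - \<Psi> a c b d 0 + \<Psi> a d b c 0 + \<Psi> c d a b 0 - \<Psi> b d a c 0 + \<Psi> b c a d 0
    = integral ?C (\<lambda>z. \<omega> a b z * \<omega> c d z - \<omega> a c z * \<omega> b d z + \<omega> a d z * \<omega> b c z 
        + \<omega> c d z * \<omega> a b z - \<omega> b d z * \<omega> a c z + \<omega> b c z * \<omega> a d z)"
    unfolding \<Psi>_def
    by (subst integral_diff integral_add; (intro integrable_continuous continuous_intros cs)?)+ simp
  also have "\<dots> = integral ?C (\<lambda>z::'a. 0)"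
    using sq by (intro integral_cong) (simp add: algebra_simps)
  finally have zero: "\<Psi> a b c d v - \<Psi> a c b d v + \<Psi> a d b c v + \<Psi> c d a b v - \<Psi> b d a c v + \<Psi> b c a d v = 0" for v
    using wedge_translation_invariant[OF per, of a b v c d] unfolding \<Psi>_def by simp
  have c2: "continuous_on UNIV (\<Psi> p q x y)" for p q x y
    unfolding \<Psi>_def
    by (intro integral_continuous_on_param, unfold case_prod_beta)
      (intro continuous_intros ct continuous_on_UNIV_compose[OF cont])
  have avg: "integral ?C (\<Psi> p q x y) = J p q * J x y" for p q x y
  proof -
    have "integral ?C (\<Psi> p q x y) = integral ?C (\<lambda>z. integral ?C (\<lambda>v. \<omega> p q (z + v) * \<omega> x y z))"
      unfolding \<Psi>_def
      by (intro integral_swap_continuous, unfold case_prod_beta)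
        (intro continuous_intros ct continuous_on_UNIV_compose[OF cont])
    also have "\<dots> = integral ?C (\<lambda>z. J p q * \<omega> x y z)"
      using integral_periodic_shift[OF cont per, of p q]
      by (intro integral_cong) (simp add: J_def add.commute)
    finally show ?thesis by (simp add: J_def)
  qed
  have i: "\<Psi> p q x y integrable_on ?C" for p q x y
    by (intro integrable_continuous continuous_on_subset[OF c2]) auto
  have "0 = integral ?C (\<lambda>v. \<Psi> a b c d v - \<Psi> a c b d v + \<Psi> a d b c v + \<Psi> c d a b v - \<Psi> b d a c v + \<Psi> b c a d v)"
    by (simp only: zero integral_0)
  also have "\<dots> = J a b * J c d - J a c * J b d + J a d * J b c + J c d * J a b - J b d * J a c + J b c * J a d"
    by (subst integral_diff integral_add; (intro integrable_add integrable_diff i)?)+ (simp add: avg)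
  finally show ?thesis by (simp add: algebra_simps)
qed

end

section \<open>The Gauss form\<close>

text \<open>The factor \<open>1 / (4 * pi)\<close> of the linking number is omitted.\<close>

definition gauss_form :: "real^3 \<Rightarrow> real^3 \<Rightarrow> real^3 \<Rightarrow> real" where
  "gauss_form r u v = (r \<bullet> cross3 u v) / norm r ^ 3"

text \<open>The primed arguments are the derivatives of \<open>r\<close>, \<open>u\<close>,
  \<open>v\<close> along a curve; the last term comes from differentiating the inverse cube of the
  norm.\<close>

definition gauss_form_deriv ::
    "real^3 \<Rightarrow> real^3 \<Rightarrow> real^3 \<Rightarrow> real^3 \<Rightarrow> real^3 \<Rightarrow> real^3 \<Rightarrow> real" where
  "gauss_form_deriv r r' u u' v v' =
     (r' \<bullet> cross3 u v + r \<bullet> cross3 u' v + r \<bullet> cross3 u v') / norm r ^ 3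
     - 3 * (r \<bullet> r') * (r \<bullet> cross3 u v) / norm r ^ 5"

lemma bounded_bilinear_cross3: "bounded_bilinear cross3"
  using bilinear_cross bilinear_conv_bounded_bilinear by blast

lemma continuous_on_gauss_form:
  assumes "continuous_on S r" "continuous_on S u" "continuous_on S v" "\<And>x. x \<in> S \<Longrightarrow> r x \<noteq> 0"
  shows "continuous_on S (\<lambda>x. gauss_form (r x) (u x) (v x))"
  unfolding gauss_form_def using assms
  by (intro continuous_intros bounded_bilinear.continuous_on[OF bounded_bilinear_cross3]) auto

lemma continuous_on_gauss_form_deriv:
  assumes "continuous_on S r" "continuous_on S r'" "continuous_on S u" "continuous_on S u'"
    "continuous_on S v" "continuous_on S v'" "\<And>x. x \<in> S \<Longrightarrow> r x \<noteq> 0"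
  shows "continuous_on S (\<lambda>x. gauss_form_deriv (r x) (r' x) (u x) (u' x) (v x) (v' x))"
  unfolding gauss_form_deriv_def using assms
  by (intro continuous_intros bounded_bilinear.continuous_on[OF bounded_bilinear_cross3]) auto

lemma has_vector_derivative_gauss_form:
  assumes r: "(r has_vector_derivative r') (at t)" and u: "(u has_vector_derivative u') (at t)"
    and v: "(v has_vector_derivative v') (at t)" and nz: "r t \<noteq> 0"
  shows "((\<lambda>s. gauss_form (r s) (u s) (v s)) has_vector_derivative
           gauss_form_deriv (r t) r' (u t) u' (v t) v') (at t)"
proof -
  have pos: "r t \<bullet> r t > 0" using nz by simp
  have c: "((\<lambda>s. cross3 (u s) (v s)) has_vector_derivative (cross3 (u t) v' + cross3 u' (v t))) (at t)"
    using bounded_bilinear.has_vector_derivative[OF bounded_bilinear_cross3 u v] .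
  have n: "((\<lambda>s. r s \<bullet> cross3 (u s) (v s)) has_real_derivative
      (r t \<bullet> (cross3 (u t) v' + cross3 u' (v t)) + r' \<bullet> cross3 (u t) (v t))) (at t)"
    using bounded_bilinear.has_vector_derivative[OF bounded_bilinear_inner r c]
    by (simp add: has_real_derivative_iff_has_vector_derivative)
  have q: "((\<lambda>s. r s \<bullet> r s) has_real_derivative (2 * (r t \<bullet> r'))) (at t)"
    using bounded_bilinear.has_vector_derivative[OF bounded_bilinear_inner r r]
    by (simp add: has_real_derivative_iff_has_vector_derivative inner_commute)
  have m: "((\<lambda>s. norm (r s) ^ 3) has_real_derivative 3 * norm (r t) * (r t \<bullet> r')) (at t)"
  proof -
    have "((\<lambda>s. sqrt (f s) ^ 3) has_real_derivative 3 * sqrt (f t) * d) (at t)"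
      if "(f has_real_derivative 2 * d) (at t)" "f t > 0" for f d
      using that by (auto intro!: derivative_eq_intros simp: field_simps power2_eq_square)
    from this[OF q pos] show ?thesis by (simp add: norm_eq_sqrt_inner)
  qed
  have "(x * R ^ 3 - y * (3 * R * p)) / (R ^ 3 * R ^ 3) = x / R ^ 3 - 3 * p * y / R ^ 5"
    if "R \<noteq> 0" for x y p R :: real
    using that by (simp add: field_simps eval_nat_numeral)
  from this[of "norm (r t)"] DERIV_divide[OF n m] nz show ?thesis
    unfolding gauss_form_def gauss_form_deriv_def has_real_derivative_iff_has_vector_derivative[symmetric]
    by (simp add: inner_add_right add_ac)
qed

text \<open>The vectors \<open>w1\<close>, \<open>w2\<close>, \<open>w3\<close> stand for first
  derivatives of a map and \<open>w12\<close>, \<open>w13\<close>, \<open>w23\<close> for its mixed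
  second derivatives, whose contributions cancel by antisymmetry. What remains says that the
  inverse-square field has zero divergence.\<close>

lemma gauss_form_closed:
  assumes "r \<noteq> 0"
  shows "gauss_form_deriv r w3 w1 w13 w2 w23 + gauss_form_deriv r w1 w2 w12 w3 w13
       + gauss_form_deriv r w2 w3 w23 w1 w12 = 0"
proof -
  define d where "d = w1 \<bullet> cross3 w2 w3"
  have "w3 \<bullet> cross3 w1 w2 + r \<bullet> cross3 w13 w2 + r \<bullet> cross3 w1 w23
     + (w1 \<bullet> cross3 w2 w3 + r \<bullet> cross3 w12 w3 + r \<bullet> cross3 w2 w13)
     + (w2 \<bullet> cross3 w3 w1 + r \<bullet> cross3 w23 w1 + r \<bullet> cross3 w3 w12) = 3 * d" (is "?a + ?b + ?c = _")
    unfolding d_def cross3_def inner_vec_def sum_3 vector_3 by (simp add: algebra_simps)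
  \<comment> \<open>This is the expansion of \<open>r\<close> in cross products of the
    \<open>w\<close>'s, scaled by their triple product and paired with \<open>r\<close>.\<close>
  moreover have "(r \<bullet> w3) * (r \<bullet> cross3 w1 w2) + (r \<bullet> w1) * (r \<bullet> cross3 w2 w3)
     + (r \<bullet> w2) * (r \<bullet> cross3 w3 w1) = norm r ^ 2 * d" (is "?x + ?y + ?z = _")
    unfolding d_def cross3_def power2_norm_eq_inner inner_vec_def sum_3 vector_3
    by (simp add: algebra_simps)
  ultimately have "(?a + ?b + ?c) / norm r ^ 3 - 3 * (?x + ?y + ?z) / norm r ^ 5 = 0"
    using assms by (simp add: field_simps eval_nat_numeral)
  then show ?thesis
    unfolding gauss_form_deriv_def by (simp add: add_divide_distrib algebra_simps)
qed

text \<open>The left side is alternating in four vectors of 3-space, so it vanishes; the proof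
  verifies this in coordinates.\<close>

lemma gauss_form_pluecker:
  "gauss_form r a b * gauss_form r c d - gauss_form r a c * gauss_form r b d
     + gauss_form r a d * gauss_form r b c = 0"
proof -
  have "(r \<bullet> cross3 a b) * (r \<bullet> cross3 c d) - (r \<bullet> cross3 a c) * (r \<bullet> cross3 b d)
     + (r \<bullet> cross3 a d) * (r \<bullet> cross3 b c) = 0"
    unfolding cross3_def inner_vec_def sum_3 vector_3 by (simp add: algebra_simps)
  then have "((r \<bullet> cross3 a b) * (r \<bullet> cross3 c d) - (r \<bullet> cross3 a c) * (r \<bullet> cross3 b d)
     + (r \<bullet> cross3 a d) * (r \<bullet> cross3 b c)) / (norm r ^ 3 * norm r ^ 3) = 0" by simp
  then show ?thesis
    unfolding gauss_form_def by (simp add: add_divide_distrib diff_divide_distrib)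
qed

section \<open>Pulling back the Gauss form along maps of class C^2\<close>

locale C2_map =
  fixes h :: "'a::euclidean_space \<Rightarrow> real^3" and D :: "'a \<Rightarrow> 'a \<Rightarrow> real^3"
    and DD :: "'a \<Rightarrow> 'a \<Rightarrow> 'a \<Rightarrow> real^3"
  assumes dh: "has_dderiv h a (D a)" and dD: "has_dderiv (D a) b (DD a b)"
    and sym: "DD a b z = DD b a z"
    and cont_h: "continuous_on UNIV h" and cont_D: "continuous_on UNIV (D a)"
    and cont_DD: "continuous_on UNIV (DD a b)"

locale gauss_map = C2_map +
  assumes nonzero: "h z \<noteq> 0"
begin

text \<open>This is the pullback of the area form of the unit sphere under the direction
  \<open>h / norm h\<close>.\<close>

definition pullback :: "'a \<Rightarrow> 'a \<Rightarrow> 'a \<Rightarrow> real" where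
  "pullback a b z = gauss_form (h z) (D a z) (D b z)"

definition pullback_deriv :: "'a \<Rightarrow> 'a \<Rightarrow> 'a \<Rightarrow> 'a \<Rightarrow> real" where
  "pullback_deriv a b c z = gauss_form_deriv (h z) (D c z) (D a z) (DD a c z) (D b z) (DD b c z)"

sublocale closed_two_form pullback pullback_deriv
proof
  fix a b c z :: 'a
  show "pullback a b z = - pullback b a z"
    unfolding pullback_def gauss_form_def by (subst cross_skew) simp
  show "continuous_on UNIV (pullback a b)"
    unfolding pullback_def by (intro continuous_on_gauss_form cont_h cont_D nonzero)
  show "continuous_on UNIV (pullback_deriv a b c)"
    unfolding pullback_deriv_def
    by (intro continuous_on_gauss_form_deriv cont_h cont_D cont_DD nonzero)
  show "has_dderiv (pullback a b) c (pullback_deriv a b c)"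
    unfolding has_dderiv_def pullback_def pullback_deriv_def
  proof
    fix z
    show "((\<lambda>s. gauss_form (h (z + s *\<^sub>R c)) (D a (z + s *\<^sub>R c)) (D b (z + s *\<^sub>R c))) has_vector_derivative
      gauss_form_deriv (h z) (D c z) (D a z) (DD a c z) (D b z) (DD b c z)) (at 0)"
      using has_vector_derivative_gauss_form[of "\<lambda>s. h (z + s *\<^sub>R c)" "D c z" 0
          "\<lambda>s. D a (z + s *\<^sub>R c)" "DD a c z" "\<lambda>s. D b (z + s *\<^sub>R c)" "DD b c z"]
        dh[of c] dD[of a c] dD[of b c] nonzero[of z]
      by (simp add: has_dderiv_def)
  qed
  show "pullback_deriv a b c z + pullback_deriv b c a z + pullback_deriv c a b z = 0"
    unfolding pullback_deriv_def
    using gauss_form_closed[OF nonzero[of z], of "D c z" "D a z" "DD a c z" "D b z" "DD b c z" "DD b a z"]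
    by (simp add: sym[of c a] sym[of a b] sym[of c b])
qed

end

section \<open>Continuously differentiable functions of two variables\<close>

definition partials ::
    "(real \<times> real \<Rightarrow> 'b::real_normed_vector) \<Rightarrow> (real \<times> real \<Rightarrow> 'b) \<Rightarrow> (real \<times> real \<Rightarrow> 'b) \<Rightarrow> bool" where
  "partials f f1 f2 \<longleftrightarrow>
     (\<forall>x y. ((\<lambda>s. f (s, y)) has_vector_derivative f1 (x, y)) (at x) \<and>
            ((\<lambda>s. f (x, s)) has_vector_derivative f2 (x, y)) (at y))"

text \<open>This recursive regularity is stable under sums, bilinear products and inverse norms,
  which is what the unit normal in \<open>torus_shift\<close> calls for.\<close>

fun Ck :: "nat \<Rightarrow> (real \<times> real \<Rightarrow> 'b::real_normed_vector) \<Rightarrow> bool" where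
  "Ck 0 f \<longleftrightarrow> continuous_on UNIV f"
| "Ck (Suc k) f \<longleftrightarrow> continuous_on UNIV f \<and> (\<exists>f1 f2. partials f f1 f2 \<and> Ck k f1 \<and> Ck k f2)"

lemma Ck_continuous: "Ck k f \<Longrightarrow> continuous_on UNIV f"
  by (cases k) auto

lemma Ck_Suc_imp_Ck: "Ck (Suc k) f \<Longrightarrow> Ck k f"
proof (induction k arbitrary: f)
  case (Suc k)
  then obtain f1 f2 where "partials f f1 f2" "Ck (Suc k) f1" "Ck (Suc k) f2"
    using Ck.simps(2) by blast
  then show ?case using Suc.IH Ck_continuous[OF Suc.prems] Ck.simps(2) by blast
qed simp

lemma Ck_const: "Ck k (\<lambda>_. c)"
proof (induction k arbitrary: c)
  case (Suc k)
  have "partials (\<lambda>_. c) (\<lambda>_. 0) (\<lambda>_. 0)" by (simp add: partials_def)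
  then show ?case using Suc[of 0] by auto
qed simp

lemma Ck_add: "Ck k f \<Longrightarrow> Ck k g \<Longrightarrow> Ck k (\<lambda>z. f z + g z)"
proof (induction k arbitrary: f g)
  case (Suc k)
  then obtain f1 f2 g1 g2 where "partials f f1 f2" "partials g g1 g2"
    "Ck k f1" "Ck k f2" "Ck k g1" "Ck k g2" by auto
  moreover from this have "partials (\<lambda>z. f z + g z) (\<lambda>z. f1 z + g1 z) (\<lambda>z. f2 z + g2 z)"
    by (auto simp: partials_def intro: has_vector_derivative_add)
  moreover have "continuous_on UNIV (\<lambda>z. f z + g z)"
    using Suc.prems by (auto intro: continuous_intros)
  ultimately show ?case using Suc.IH[of f1 g1] Suc.IH[of f2 g2] unfolding Ck.simps by blast
qed (auto intro: continuous_intros)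

lemma Ck_bilinear:
  assumes B: "bounded_bilinear B"
  shows "Ck k f \<Longrightarrow> Ck k g \<Longrightarrow> Ck k (\<lambda>z. B (f z) (g z))"
proof (induction k arbitrary: f g)
  case 0
  then show ?case by (auto intro: bounded_bilinear.continuous_on[OF B])
next
  case (Suc k)
  then obtain f1 f2 g1 g2 where *: "partials f f1 f2" "partials g g1 g2"
    "Ck k f1" "Ck k f2" "Ck k g1" "Ck k g2" by auto
  from *(1,2) have "partials (\<lambda>z. B (f z) (g z)) (\<lambda>z. B (f z) (g1 z) + B (f1 z) (g z))
      (\<lambda>z. B (f z) (g2 z) + B (f2 z) (g z))"
    by (auto simp: partials_def intro!: bounded_bilinear.has_vector_derivative[OF B])
  moreover have "Ck k (\<lambda>z. B (f z) (g1 z) + B (f1 z) (g z))" "Ck k (\<lambda>z. B (f z) (g2 z) + B (f2 z) (g z))"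
    using * Suc.prems[THEN Ck_Suc_imp_Ck] by (auto intro!: Ck_add Suc.IH)
  moreover have "continuous_on UNIV (\<lambda>z. B (f z) (g z))"
    using Suc.prems by (auto intro: bounded_bilinear.continuous_on[OF B])
  ultimately show ?case by auto
qed

lemma has_vector_derivative_inverse_norm:
  fixes f :: "real \<Rightarrow> 'b::real_inner"
  assumes f: "(f has_vector_derivative f') (at t)" and nz: "f t \<noteq> 0"
  shows "((\<lambda>s. inverse (norm (f s))) has_vector_derivative
     (f t \<bullet> f') * (- inverse (norm (f t)) * (inverse (norm (f t)) * inverse (norm (f t))))) (at t)"
proof -
  have q: "((\<lambda>s. f s \<bullet> f s) has_real_derivative (2 * (f t \<bullet> f'))) (at t)"
    using bounded_bilinear.has_vector_derivative[OF bounded_bilinear_inner f f]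
    by (simp add: has_real_derivative_iff_has_vector_derivative inner_commute)
  have "((\<lambda>s. inverse (sqrt (g s))) has_real_derivative
      d * (- inverse (sqrt (g t)) * (inverse (sqrt (g t)) * inverse (sqrt (g t))))) (at t)"
    if "(g has_real_derivative 2 * d) (at t)" "g t > 0" for g d
    using that by (auto intro!: derivative_eq_intros simp: field_simps)
  from this[OF q] nz show ?thesis
    by (simp add: norm_eq_sqrt_inner has_real_derivative_iff_has_vector_derivative)
qed

text \<open>The partial derivatives of the inverse norm \<open>n\<close> are products of
  \<open>n\<close>, \<open>f\<close> and partials of \<open>f\<close>, so the induction hypothesis
  for \<open>n\<close> itself bounds their regularity. The factor \<open>- 1\<close> is split off so
  that they are literally iterated bilinear products.\<close>

lemma Ck_inverse_norm:
  fixes f :: "real \<times> real \<Rightarrow> 'b::real_inner"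
  assumes nz: "\<And>z. f z \<noteq> 0"
  shows "Ck k f \<Longrightarrow> Ck k (\<lambda>z. inverse (norm (f z)))"
proof (induction k)
  case 0
  then show ?case using nz by (auto intro!: continuous_intros)
next
  case (Suc k)
  then obtain f1 f2 where *: "partials f f1 f2" "Ck k f1" "Ck k f2" by auto
  define n where "n = (\<lambda>z. inverse (norm (f z)))"
  have n: "Ck k n" unfolding n_def by (rule Suc.IH[OF Ck_Suc_imp_Ck[OF Suc.prems]])
  have p: "partials n (\<lambda>z. (f z \<bullet> f1 z) * (- 1 * n z * (n z * n z)))
       (\<lambda>z. (f z \<bullet> f2 z) * (- 1 * n z * (n z * n z)))"
    unfolding partials_def n_def
  proof (intro allI conjI)
    fix x y
    have d: "((\<lambda>s. f (s, y)) has_vector_derivative f1 (x, y)) (at x)"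
      "((\<lambda>s. f (x, s)) has_vector_derivative f2 (x, y)) (at y)"
      using *(1) by (auto simp: partials_def)
    show "((\<lambda>s. inverse (norm (f (s, y)))) has_vector_derivative (f (x, y) \<bullet> f1 (x, y)) *
        (- 1 * inverse (norm (f (x, y))) * (inverse (norm (f (x, y))) * inverse (norm (f (x, y)))))) (at x)"
      using has_vector_derivative_inverse_norm[OF d(1) nz] by simp
    show "((\<lambda>s. inverse (norm (f (x, s)))) has_vector_derivative (f (x, y) \<bullet> f2 (x, y)) *
        (- 1 * inverse (norm (f (x, y))) * (inverse (norm (f (x, y))) * inverse (norm (f (x, y)))))) (at y)"
      using has_vector_derivative_inverse_norm[OF d(2) nz] by simp
  qed
  have "Ck k (\<lambda>z. (f z \<bullet> f1 z) * (- 1 * n z * (n z * n z)))"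
     "Ck k (\<lambda>z. (f z \<bullet> f2 z) * (- 1 * n z * (n z * n z)))"
    using * n Suc.prems[THEN Ck_Suc_imp_Ck]
    by (intro Ck_bilinear[OF bounded_bilinear_mult] Ck_bilinear[OF bounded_bilinear_inner] Ck_const; simp)+
  moreover have "continuous_on UNIV n"
    using Suc.prems nz unfolding n_def by (auto intro!: continuous_intros)
  ultimately show ?case using p unfolding n_def[symmetric] by auto
qed

lemma smooth_map_partials:
  assumes "smooth_map F"
  shows "partials (iter_pd bs F) (iter_pd (True # bs) F) (iter_pd (False # bs) F)"
proof -
  have "(\<lambda>s. iter_pd bs F (s, y)) differentiable (at x)" "(\<lambda>s. iter_pd bs F (x, s)) differentiable (at y)"
    for x y using assms unfolding smooth_map_def by blast+
  then show ?thesis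
    unfolding partials_def iter_pd.simps pd1_def pd2_def vector_derivative_works by simp
qed

lemma smooth_map_Ck: "smooth_map F \<Longrightarrow> Ck k (iter_pd bs F)"
proof (induction k arbitrary: bs)
  case (Suc k)
  have "continuous_on UNIV (iter_pd bs F)" using Suc.prems by (simp add: smooth_map_def)
  with smooth_map_partials[OF Suc.prems, of bs] Suc.IH[OF Suc.prems] show ?case
    unfolding Ck.simps by blast
qed (simp add: smooth_map_def)

text \<open>Existence of both partials and continuity of the second give a total derivative; the
  chain rule along a line does the rest.\<close>

lemma partials_has_dderiv:
  fixes f :: "real \<times> real \<Rightarrow> 'b::real_normed_vector"
  assumes p: "partials f f1 f2" and cont: "continuous_on UNIV f2"
  shows "has_dderiv f v (\<lambda>z. fst v *\<^sub>R f1 z + snd v *\<^sub>R f2 z)"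
  unfolding has_dderiv_def
proof
  fix z :: "real \<times> real"
  obtain x y where z: "z = (x, y)" by (cases z)
  have "((\<lambda>(x, y). f (x, y)) has_derivative
     (\<lambda>(tx, ty). tx *\<^sub>R f1 (x, y) + blinfun_scaleR_left (f2 (x, y)) ty)) (at (x, y) within UNIV \<times> UNIV)"
  proof (rule has_derivative_partialsI)
    have "continuous_on UNIV (\<lambda>z. blinfun_scaleR_left (f2 z))"
      by (intro bounded_linear.continuous_on[OF bounded_linear_blinfun_scaleR_left] cont)
    then show "continuous (at (x, y) within UNIV \<times> UNIV) (\<lambda>(x, y). blinfun_scaleR_left (f2 (x, y)))"
      by (simp add: continuous_on_eq_continuous_at case_prod_beta')
  qed (use p in \<open>auto simp: partials_def has_vector_derivative_def\<close>)
  then have "(f has_derivative (\<lambda>t. fst t *\<^sub>R f1 z + snd t *\<^sub>R f2 z)) (at (z + 0 *\<^sub>R v))"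
    by (simp add: z case_prod_beta')
  moreover have "((\<lambda>s. z + s *\<^sub>R v) has_derivative (\<lambda>s. s *\<^sub>R v)) (at 0)"
    by (auto intro!: derivative_eq_intros)
  ultimately have "((\<lambda>s. f (z + s *\<^sub>R v)) has_derivative
     (\<lambda>s. fst (s *\<^sub>R v) *\<^sub>R f1 z + snd (s *\<^sub>R v) *\<^sub>R f2 z)) (at 0)"
    by (rule has_derivative_compose[rotated])
  then show "((\<lambda>s. f (z + s *\<^sub>R v)) has_vector_derivative fst v *\<^sub>R f1 z + snd v *\<^sub>R f2 z) (at 0)"
    by (simp add: has_vector_derivative_def scaleR_add_right)
qed

text \<open>Recover \<open>f\<close> from \<open>f1\<close> by integrating in the first variable,
  differentiate under the integral in the second, then differentiate in the upper limit.\<close>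

lemma mixed_partials_eq:
  fixes f :: "real \<times> real \<Rightarrow> 'b::euclidean_space"
  assumes f: "partials f f1 f2" and f1: "partials f1 f11 f12" and f2: "partials f2 f21 f22"
    and cont: "continuous_on UNIV f1" "continuous_on UNIV f12"
  shows "f12 z = f21 z"
proof -
  obtain x y where z: "z = (x, y)" by (cases z)
  \<comment> \<open>Any base point left of \<open>x\<close> would do; it makes \<open>x\<close>
    interior to \<open>{a..x + 1}\<close>.\<close>
  define a where "a = x - 1"
  have c1: "continuous_on S (\<lambda>s. f1 (s, y))" for S y
    by (intro continuous_on_UNIV_compose[OF cont(1)] continuous_intros)
  have c12: "continuous_on S (\<lambda>s. f12 (s, y))" for S y
    by (intro continuous_on_UNIV_compose[OF cont(2)] continuous_intros)
  have ftc: "f (t, y) = f (a, y) + integral {a..t} (\<lambda>s. f1 (s, y))" if "a \<le> t" for t y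
    using fundamental_theorem_of_calculus[OF that, of "\<lambda>s. f (s, y)" "\<lambda>s. f1 (s, y)"] f
    by (auto simp: partials_def has_vector_derivative_at_within dest: integral_unique)
  have f2_eq: "f2 (t, y) = f2 (a, y) + integral {a..t} (\<lambda>s. f12 (s, y))" if "a \<le> t" for t
  proof -
    have "((\<lambda>y. integral (cbox a t) (\<lambda>s. f1 (s, y))) has_vector_derivative
        integral (cbox a t) (\<lambda>s. f12 (s, y))) (at y within UNIV)"
    proof (rule leibniz_rule_vector_derivative)
      show "continuous_on (UNIV \<times> cbox a t) (\<lambda>(x, s). f12 (s, x))"
        unfolding case_prod_beta by (intro continuous_on_UNIV_compose[OF cont(2)] continuous_intros)
    qed (use f1 in \<open>auto simp: partials_def intro!: integrable_continuous_real c1\<close>)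
    moreover have "((\<lambda>y. f (a, y)) has_vector_derivative f2 (a, y)) (at y)"
      using f by (simp add: partials_def)
    ultimately have "((\<lambda>y. f (a, y) + integral (cbox a t) (\<lambda>s. f1 (s, y))) has_vector_derivative
      f2 (a, y) + integral (cbox a t) (\<lambda>s. f12 (s, y))) (at y)"
      by (intro has_vector_derivative_add) auto
    then have "((\<lambda>y. f (t, y)) has_vector_derivative
      f2 (a, y) + integral (cbox a t) (\<lambda>s. f12 (s, y))) (at y)"
      by (simp add: ftc[OF that])
    moreover have "((\<lambda>y. f (t, y)) has_vector_derivative f2 (t, y)) (at y)"
      using f by (simp add: partials_def)
    ultimately show ?thesis using vector_derivative_unique_at by fastforce
  qed
  have "((\<lambda>t. f2 (a, y) + integral {a..t} (\<lambda>s. f12 (s, y))) has_vector_derivative 0 + f12 (x, y))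
      (at x within {a..x + 1})"
    by (intro has_vector_derivative_add has_vector_derivative_const integral_has_vector_derivative c12)
      (auto simp: a_def)
  then have d: "((\<lambda>t. f2 (a, y) + integral {a..t} (\<lambda>s. f12 (s, y))) has_vector_derivative f12 (x, y))
      (at x within {a..x + 1})" by simp
  have "((\<lambda>t. f2 (t, y)) has_vector_derivative f12 (x, y)) (at x within {a..x + 1})"
    by (rule has_vector_derivative_transform[OF _ f2_eq d]) (auto simp: a_def)
  moreover have "((\<lambda>t. f2 (t, y)) has_vector_derivative f21 (x, y)) (at x within {a..x + 1})"
    using f2 by (auto simp: partials_def intro: has_vector_derivative_at_within)
  ultimately show ?thesis
    using vector_derivative_unique_within_closed_interval[of a "x + 1" x] by (auto simp: a_def z)
qed

section \<open>Linking matrix of disjoint tori\<close>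

lemma has_dderiv_diff:
  assumes "has_dderiv f v f'" "has_dderiv g v g'"
  shows "has_dderiv (\<lambda>z. f z - g z) v (\<lambda>z. f' z - g' z)"
  using assms unfolding has_dderiv_def by (intro allI has_vector_derivative_diff) auto

lemma has_dderiv_zero:
  assumes "has_dderiv f 0 f'" shows "f' = (\<lambda>_. 0)"
proof
  fix z
  have "((\<lambda>s. f z) has_vector_derivative f' z) (at 0)"
    using assms by (simp add: has_dderiv_def)
  then show "f' z = 0" by (rule vector_derivative_unique_at[OF _ has_vector_derivative_const])
qed

text \<open>The second factor is either another torus, for linking, or the line of
  \<open>C2_map_parabola\<close>, for pushing a point to infinity.\<close>

lemma C2_map_difference:
  assumes "C2_map F dF ddF" "C2_map G dG ddG"
  shows "C2_map (\<lambda>z. F (fst z) - G (snd z)) (\<lambda>a z. dF (fst a) (fst z) - dG (snd a) (snd z))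
     (\<lambda>a b z. ddF (fst a) (fst b) (fst z) - ddG (snd a) (snd b) (snd z))"
proof -
  interpret F: C2_map F dF ddF by fact
  interpret G: C2_map G dG ddG by fact
  have fst: "has_dderiv (\<lambda>z. f (fst z)) v (\<lambda>z. f' (fst z))" if "has_dderiv f (fst v) f'"
    for v :: "'a \<times> 'b" and f f' :: "'a \<Rightarrow> real^3"
    using that by (simp add: has_dderiv_def)
  have snd: "has_dderiv (\<lambda>z. f (snd z)) v (\<lambda>z. f' (snd z))" if "has_dderiv f (snd v) f'"
    for v :: "'a \<times> 'b" and f f' :: "'b \<Rightarrow> real^3"
    using that by (simp add: has_dderiv_def)
  show ?thesis
  proof
    fix a b z :: "'a \<times> 'b"
    show "has_dderiv (\<lambda>z. F (fst z) - G (snd z)) a (\<lambda>z. dF (fst a) (fst z) - dG (snd a) (snd z))"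
      by (intro has_dderiv_diff fst snd F.dh G.dh)
    show "has_dderiv (\<lambda>z. dF (fst a) (fst z) - dG (snd a) (snd z)) b
       (\<lambda>z. ddF (fst a) (fst b) (fst z) - ddG (snd a) (snd b) (snd z))"
      by (intro has_dderiv_diff fst snd F.dD G.dD)
    show "ddF (fst a) (fst b) (fst z) - ddG (snd a) (snd b) (snd z)
       = ddF (fst b) (fst a) (fst z) - ddG (snd b) (snd a) (snd z)"
      by (simp add: F.sym G.sym)
  qed (intro continuous_intros continuous_on_UNIV_compose[OF F.cont_h] continuous_on_UNIV_compose[OF G.cont_h]
      continuous_on_UNIV_compose[OF F.cont_D] continuous_on_UNIV_compose[OF G.cont_D]
      continuous_on_UNIV_compose[OF F.cont_DD] continuous_on_UNIV_compose[OF G.cont_DD])+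
qed

text \<open>The parametrisation by \<open>1 + t\<^sup>2\<close> makes the radial escape from \<open>p\<close> to infinity a map on the whole
  real line, so that \<open>C2_map_difference\<close> applies to it.\<close>

lemma C2_map_parabola:
  "C2_map (\<lambda>t::real. (1 + t\<^sup>2) *\<^sub>R p) (\<lambda>v t. (2 * t * v) *\<^sub>R p) (\<lambda>v w t. (2 * v * w) *\<^sub>R p)"
  by standard
    (auto simp: has_dderiv_def intro!: derivative_eq_intros continuous_intros
        simp: has_vector_derivative_def algebra_simps)

section \<open>Vanishing of the degree around an outermost point\<close>

lemma norm_cross3_le: "norm (cross3 u v) \<le> norm u * norm v"
proof (rule power2_le_imp_le)
  show "(norm (cross3 u v))\<^sup>2 \<le> (norm u * norm v)\<^sup>2"
    using norm_cross_dot[of u v] zero_le_power2[of "u \<bullet> v"] by linarith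
qed simp

lemma abs_gauss_form_le:
  assumes "norm u \<le> M" "norm v \<le> M" "norm r \<ge> m" "m > 0"
  shows "\<bar>gauss_form r u v\<bar> \<le> M\<^sup>2 / m\<^sup>2"
proof -
  have r: "norm r > 0" using assms by linarith
  have M: "M \<ge> 0" using assms(1) norm_ge_zero[of u] by linarith
  have "\<bar>r \<bullet> cross3 u v\<bar> \<le> norm r * (norm u * norm v)"
    by (rule order_trans[OF Cauchy_Schwarz_ineq2]) (simp add: norm_cross3_le mult_left_mono)
  also have "\<dots> \<le> norm r * (M * M)"
    using assms M by (intro mult_left_mono mult_mono) auto
  finally have "\<bar>gauss_form r u v\<bar> \<le> norm r * (M * M) / norm r ^ 3"
    unfolding gauss_form_def by (simp add: divide_right_mono)
  also have "\<dots> = M\<^sup>2 / (norm r)\<^sup>2"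
    using r by (simp add: field_simps power2_eq_square power3_eq_cube)
  also have "\<dots> \<le> M\<^sup>2 / m\<^sup>2"
    using assms by (intro divide_left_mono power_mono mult_pos_pos) auto
  finally show ?thesis .
qed

lemma periodic_prodD:
  fixes F :: "real \<times> real \<Rightarrow> 'b"
  assumes "periodic F" shows "F (u + (1, 0)) = F u" "F (u + (0, 1)) = F u"
  using assms unfolding periodic_def by (cases u; auto simp: Basis_prod_def)+

text \<open>The integral is, up to sign, \<open>4 * pi\<close> times the degree of \<open>F\<close>
  around \<open>p\<close>. It is unchanged as \<open>p\<close> escapes radially, and inverse-square
  decay forces it to zero.\<close>

lemma degree_around_outer_point:
  fixes F :: "real \<times> real \<Rightarrow> real^3"
  assumes F: "C2_map F dF ddF" and per: "periodic F" "\<And>v. periodic (dF v)"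
    and far: "\<And>x. norm (F x) \<le> norm p" and avoid: "\<And>x. F x \<noteq> p"
  shows "integral (cbox 0 One) (\<lambda>x. gauss_form (F x - p) (dF (1, 0) x) (dF (0, 1) x)) = 0"
    (is "?K = 0")
proof -
  interpret F: C2_map F dF ddF by fact
  have p: "norm p > 0" using far[of 0] avoid[of 0] by auto
  interpret h: gauss_map "\<lambda>z. F (fst z) - (1 + (snd z)\<^sup>2) *\<^sub>R p"
    "\<lambda>a z. dF (fst a) (fst z) - (2 * snd z * snd a) *\<^sub>R p"
    "\<lambda>a b z. ddF (fst a) (fst b) (fst z) - (2 * snd a * snd b) *\<^sub>R p"
  proof (rule gauss_map.intro[OF C2_map_difference[OF F C2_map_parabola]], unfold_locales)
    fix z :: "(real \<times> real) \<times> real"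
    show "F (fst z) - (1 + (snd z)\<^sup>2) *\<^sub>R p \<noteq> 0"
    proof
      assume eq: "F (fst z) - (1 + (snd z)\<^sup>2) *\<^sub>R p = 0"
      then have "norm (F (fst z)) = (1 + (snd z)\<^sup>2) * norm p" by (simp add: abs_of_nonneg)
      then have "(1 + (snd z)\<^sup>2) * norm p \<le> 1 * norm p" using far[of "fst z"] by simp
      \<comment> \<open>On the escape route the norm exceeds \<open>norm p\<close> except at
        parameter 0, where \<open>avoid\<close> applies.\<close>
      then have "snd z = 0" using p by (simp add: mult_le_cancel_right)
      with eq avoid[of "fst z"] show False by simp
    qed
  qed
  \<comment> \<open>The form is closed on torus times line, so its period over the torus is the same
    at parameters 0 and \<open>t\<close>.\<close>
  have K: "?K = integral (cbox 0 One) (\<lambda>x. gauss_form (F x - (1 + t\<^sup>2) *\<^sub>R p) (dF (1, 0) x) (dF (0, 1) x))" for t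
    using h.period_translation_invariant[of "((1, 0), 0)" "((0, 1), 0)" "(0, 0)" "(0, t)"]
    by (simp add: h.pullback_def periodic_prodD[OF per(1)] periodic_prodD[OF per(2)])
  have "compact (dF v ` cbox 0 One)" for v
    by (intro compact_continuous_image continuous_on_subset[OF F.cont_D]) auto
  then have "\<exists>B. \<forall>x\<in>cbox 0 One. norm (dF v x) \<le> B" for v
    using compact_imp_bounded bounded_iff by (metis imageI)
  then obtain M1 M2 where "\<And>x. x \<in> cbox 0 One \<Longrightarrow> norm (dF (1, 0) x) \<le> M1"
    "\<And>x. x \<in> cbox 0 One \<Longrightarrow> norm (dF (0, 1) x) \<le> M2" by metis
  then obtain M where M: "\<And>x. x \<in> cbox 0 One \<Longrightarrow> norm (dF (1, 0) x) \<le> M"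
    "\<And>x. x \<in> cbox 0 One \<Longrightarrow> norm (dF (0, 1) x) \<le> M" 
    by (metis max.coboundedI1 max.coboundedI2)
  have bound: "\<bar>?K\<bar> \<le> M\<^sup>2 / (t\<^sup>2 * norm p)\<^sup>2" if "t > 0" for t
  proof -
    have r: "norm (F x - (1 + t\<^sup>2) *\<^sub>R p) \<ge> t\<^sup>2 * norm p" for x
    proof -
      have "norm ((1 + t\<^sup>2) *\<^sub>R p) = (1 + t\<^sup>2) * norm p" by (simp add: abs_of_nonneg)
      then have "norm ((1 + t\<^sup>2) *\<^sub>R p) = norm p + t\<^sup>2 * norm p" by (simp only: ring_distribs mult_1)
      then show ?thesis
        using norm_triangle_ineq2[of "(1 + t\<^sup>2) *\<^sub>R p" "F x"] far[of x] by (simp add: norm_minus_commute)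
    qed
    have nz: "F x - (1 + t\<^sup>2) *\<^sub>R p \<noteq> 0" for x
    proof
      assume "F x - (1 + t\<^sup>2) *\<^sub>R p = 0"
      then have "t\<^sup>2 * norm p \<le> 0" using r[of x] by simp
      moreover have "t\<^sup>2 * norm p > 0" using p that by simp
      ultimately show False by linarith
    qed
    have "norm (integral (cbox 0 One) (\<lambda>x. gauss_form (F x - (1 + t\<^sup>2) *\<^sub>R p) (dF (1, 0) x) (dF (0, 1) x)))
       \<le> integral (cbox 0 One :: (real \<times> real) set) (\<lambda>_. M\<^sup>2 / (t\<^sup>2 * norm p)\<^sup>2)"
      (is "norm (integral _ ?f) \<le> _")
    proof (rule integral_norm_bound_integral)
      have "continuous_on UNIV ?f"
        by (rule continuous_on_gauss_form[OF continuous_on_diff[OF F.cont_h continuous_on_const]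
            F.cont_D F.cont_D nz])
      then show "?f integrable_on cbox 0 One"
        by (rule integrable_continuous[OF continuous_on_subset]) simp
      show "norm (?f x) \<le> M\<^sup>2 / (t\<^sup>2 * norm p)\<^sup>2" if "x \<in> cbox 0 One" for x
        using abs_gauss_form_le[OF M(1)[OF that] M(2)[OF that] r[of x]] \<open>t > 0\<close> p by simp
    qed (simp add: integrable_const)
    then show ?thesis unfolding K[of t] by simp
  qed
  show ?thesis
  proof (rule ccontr)
    assume nz: "?K \<noteq> 0"
    define c where "c = M\<^sup>2 / (norm p)\<^sup>2"
    \<comment> \<open>With this \<open>t\<close>, the product of \<open>t\<close> and the absolute
      value of the integral exceeds \<open>c\<close>, although decay bounds it by \<open>c\<close>;
      the summand 1 ensures \<open>t \<ge> 1\<close>.\<close>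
    define t where "t = c / \<bar>?K\<bar> + 1"
    have "c \<ge> 0" by (simp add: c_def)
    then have t: "t \<ge> 1" by (simp add: t_def)
    have "\<bar>?K\<bar> \<le> c / t ^ 4"
      using bound[of t] t by (simp add: c_def power_mult_distrib mult.commute flip: power_mult)
    also have "\<dots> \<le> c / t ^ 1"
      using t \<open>c \<ge> 0\<close> by (intro divide_left_mono power_increasing) auto
    finally have "\<bar>?K\<bar> * t \<le> c" using t by (simp add: field_simps)
    moreover have "\<bar>?K\<bar> * t = c + \<bar>?K\<bar>" using nz by (simp add: t_def field_simps)
    ultimately show False using nz by simp
  qed
qed

lemma periodic_frac:
  fixes F :: "real \<times> real \<Rightarrow> 'b"
  assumes "periodic F"
  shows "F z = F (frac (fst z), frac (snd z))"
proof -
  have B: "(1, 0) \<in> (Basis :: (real \<times> real) set)" "(0, 1) \<in> (Basis :: (real \<times> real) set)"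
    by (auto simp: Basis_prod_def)
  have "F z = F ((frac (fst z), frac (snd z)) + of_int \<lfloor>fst z\<rfloor> *\<^sub>R (1, 0) + of_int \<lfloor>snd z\<rfloor> *\<^sub>R (0, 1))"
    by (simp add: frac_def)
  then show ?thesis unfolding periodic_int[OF assms B(1)] periodic_int[OF assms B(2)] .
qed

lemma One_real_prod: "(One :: real \<times> real) = (1, 1)"
  by (simp add: Basis_prod_def)

lemma frac_mem_unit_square: "(frac x, frac y) \<in> (cbox 0 One :: (real \<times> real) set)"
  unfolding One_real_prod zero_prod_def by (simp add: cbox_Pair_eq frac_ge_0 less_imp_le[OF frac_lt_1])

lemma periodic_attains_max_norm:
  fixes F :: "real \<times> real \<Rightarrow> 'b::real_normed_vector"
  assumes "periodic F" "continuous_on UNIV F"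
  shows "\<exists>x0. \<forall>x. norm (F x) \<le> norm (F x0)"
proof -
  have c: "continuous_on (cbox 0 One) (\<lambda>x. norm (F x))"
    by (intro continuous_intros continuous_on_subset[OF assms(2)]) auto
  have ne: "cbox 0 One \<noteq> ({} :: (real \<times> real) set)"
    using frac_mem_unit_square by blast
  obtain x0 where x0: "\<forall>x\<in>cbox 0 One. norm (F x) \<le> norm (F x0)"
    using continuous_attains_sup[OF compact_cbox ne c] by blast
  have "norm (F x) \<le> norm (F x0)" for x
  proof -
    have "norm (F (frac (fst x), frac (snd x))) \<le> norm (F x0)"
      by (rule bspec[OF x0 frac_mem_unit_square])
    then show ?thesis by (simp only: periodic_frac[OF assms(1), of x, symmetric])
  qed
  then show ?thesis by blast
qed

section \<open>Singularity of the linking matrix\<close>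

text \<open>\<open>L v w\<close> is \<open>4 * pi\<close> times the linking number of the coordinate
  loops in directions \<open>v\<close> and \<open>w\<close>. The Pluecker relation is applied to
  \<open>a\<close>, \<open>b\<close> tangent to the first torus and \<open>c\<close>,
  \<open>d\<close> tangent to the second: the mixed periods are entries of \<open>L\<close> up to
  sign, the other two are degrees.\<close>

lemma linking_matrix_det:
  fixes F G :: "real \<times> real \<Rightarrow> real^3"
  assumes F: "C2_map F dF ddF" and perF: "periodic F" "\<And>v. periodic (dF v)"
    and G: "C2_map G dG ddG" and perG: "periodic G" "\<And>v. periodic (dG v)"
    and disjoint: "\<And>x y. F x \<noteq> G y"
  defines "L \<equiv> \<lambda>v w. integral (cbox 0 One) (\<lambda>x::real \<times> real.
     gauss_form (F (fst x *\<^sub>R v) - G (snd x *\<^sub>R w)) (dF v (fst x *\<^sub>R v)) (dG w (snd x *\<^sub>R w)))"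
  shows "L (1, 0) (1, 0) * L (0, 1) (0, 1) = L (1, 0) (0, 1) * L (0, 1) (1, 0)"
proof -
  interpret F: C2_map F dF ddF by fact
  interpret G: C2_map G dG ddG by fact
  interpret h: gauss_map "\<lambda>z. F (fst z) - G (snd z)" "\<lambda>a z. dF (fst a) (fst z) - dG (snd a) (snd z)"
     "\<lambda>a b z. ddF (fst a) (fst b) (fst z) - ddG (snd a) (snd b) (snd z)"
    by (rule gauss_map.intro[OF C2_map_difference[OF F G]], unfold_locales) (simp add: disjoint)
  \<comment> \<open>\<open>C2_map\<close> does not state linearity in the direction. The zero
    direction arises because each basis vector is tangent to only one torus.\<close>
  have dF0: "dF 0 = (\<lambda>_. 0)" and dG0: "dG 0 = (\<lambda>_. 0)"
    using has_dderiv_zero[OF F.dh] has_dderiv_zero[OF G.dh] .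
  let ?e = "(1, 0) :: real \<times> real" and ?f = "(0, 1) :: real \<times> real"
  let ?a = "(?e, 0 :: real \<times> real)" and ?b = "(?f, 0 :: real \<times> real)"
  let ?c = "(0 :: real \<times> real, ?e)" and ?d = "(0 :: real \<times> real, ?f)"
  define J where "J p q = integral (cbox 0 One) (h.pullback p q)" for p q
  have per: "periodic (h.pullback p q)" for p q
    using perF perG unfolding periodic_def h.pullback_def by (auto simp: Basis_prod_def)
  have basis: "?a \<in> Basis" "?b \<in> Basis" "?c \<in> Basis" "?d \<in> Basis"
    by (auto simp: Basis_prod_def)
  have period: "J p q = integral (cbox 0 One) (\<lambda>x::real \<times> real. h.pullback p q (z + fst x *\<^sub>R p + snd x *\<^sub>R q))"
    if "p \<in> Basis" "q \<in> Basis" for p q z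
    unfolding J_def by (rule h.integral_eq_period[OF per that])
  have "J ?a ?b * J ?c ?d - J ?a ?c * J ?b ?d + J ?a ?d * J ?b ?c = 0"
    unfolding J_def
    by (rule h.periods_pluecker[OF per]) (simp add: h.pullback_def gauss_form_pluecker)
  \<comment> \<open>The factors are the degrees of \<open>F\<close> around a point of
    \<open>G\<close> and of \<open>G\<close> around a point of \<open>F\<close>. The base points may
    be chosen freely, so a point of maximal norm on the union is taken.\<close>
  moreover have "J ?a ?b * J ?c ?d = 0"
  proof -
    obtain x0 where x0: "\<And>x. norm (F x) \<le> norm (F x0)"
      using periodic_attains_max_norm[OF perF(1) F.cont_h] by blast
    obtain y0 where y0: "\<And>y. norm (G y) \<le> norm (G y0)"
      using periodic_attains_max_norm[OF perG(1) G.cont_h] by blast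
    show ?thesis
    proof (cases "norm (F x0) \<le> norm (G y0)")
      case True
      then have "norm (F x) \<le> norm (G y0)" for x using x0[of x] by linarith
      from degree_around_outer_point[OF F perF this disjoint]
      have "J ?a ?b = 0"
        using period[OF basis(1,2), of "(0, y0)"] by (simp add: h.pullback_def dG0)
      then show ?thesis by simp
    next
      case False
      then have far: "norm (G y) \<le> norm (F x0)" for y using y0[of y] by linarith
      \<comment> \<open>Exchanging the roles of the tori negates all three arguments, hence the
        value.\<close>
      have flip: "gauss_form (p - q) (- u) (- v) = - gauss_form (q - p) u v" for p q u v
        unfolding gauss_form_def
        by (metis (no_types) cross_minus_left cross_minus_right inner_minus_left minus_diff_eq
            minus_divide_left minus_minus norm_minus_cancel)
      have "J ?c ?d = 0"
        using period[OF basis(3,4), of "(x0, 0)"]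
          degree_around_outer_point[OF G perG far disjoint[symmetric]]
        by (simp add: h.pullback_def dF0 flip)
      then show ?thesis by simp
    qed
  qed
  \<comment> \<open>The sign comes from the minus in \<open>F - G\<close> and cancels in each
    product of two entries. Base point 0 gives the loops used in \<open>L\<close>.\<close>
  moreover have "J (v, 0) (0, w) = - L v w" if "(v, 0 :: real \<times> real) \<in> Basis" "(0 :: real \<times> real, w) \<in> Basis" for v w
  proof -
    have "gauss_form r u (- w) = - gauss_form r u w" for r u w
      by (simp add: gauss_form_def)
    then show ?thesis
      unfolding L_def using period[OF that, of 0] by (simp add: h.pullback_def dF0 dG0)
  qed
  ultimately show ?thesis using basis by simp
qed

section \<open>Seifert forms of embedded tori\<close>

lemma periodic_dderiv:
  assumes "has_dderiv f v f'" "periodic f"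
  shows "periodic f'"
  unfolding periodic_def
proof safe
  fix e z :: 'a assume "e \<in> Basis"
  then have shift: "f (u + e) = f u" for u using assms(2) by (simp add: periodic_def)
  have "(z + e) + s *\<^sub>R v = (z + s *\<^sub>R v) + e" for s by simp
  then have "((\<lambda>s. f (z + s *\<^sub>R v)) has_vector_derivative f' (z + e)) (at 0)"
    using assms(1)[unfolded has_dderiv_def, rule_format, of "z + e"] by (simp only: shift)
  moreover have "((\<lambda>s. f (z + s *\<^sub>R v)) has_vector_derivative f' z) (at 0)"
    using assms(1) by (simp add: has_dderiv_def)
  ultimately show "f' (z + e) = f' z" by (rule vector_derivative_unique_at)
qed

lemma Ck_2_imp_C2_map:
  fixes F :: "real \<times> real \<Rightarrow> real^3"
  assumes "Ck 2 F"
  shows "\<exists>dF ddF. C2_map F dF ddF"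
proof -
  obtain F1 F2 where F: "partials F F1 F2" "Ck 1 F1" "Ck 1 F2" "continuous_on UNIV F"
    using assms by (auto simp: numeral_2_eq_2)
  obtain F11 F12 where F1: "partials F1 F11 F12" "continuous_on UNIV F11" "continuous_on UNIV F12" 
    "continuous_on UNIV F1"
    using F(2) by (auto simp: One_nat_def)
  obtain F21 F22 where F2: "partials F2 F21 F22" "continuous_on UNIV F21" "continuous_on UNIV F22"
    "continuous_on UNIV F2"
    using F(3) by (auto simp: One_nat_def)
  have F12: "F12 = F21"
    using mixed_partials_eq[OF F(1) F1(1) F2(1) F1(4) F1(3)] by blast
  have "C2_map F (\<lambda>v z. fst v *\<^sub>R F1 z + snd v *\<^sub>R F2 z)
      (\<lambda>v w z. fst v *\<^sub>R (fst w *\<^sub>R F11 z + snd w *\<^sub>R F12 z) + snd v *\<^sub>R (fst w *\<^sub>R F21 z + snd w *\<^sub>R F22 z))"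
  proof
    fix v w z :: "real \<times> real"
    show "has_dderiv F v (\<lambda>z. fst v *\<^sub>R F1 z + snd v *\<^sub>R F2 z)"
      by (rule partials_has_dderiv[OF F(1) F2(4)])
    have "has_dderiv F1 w (\<lambda>z. fst w *\<^sub>R F11 z + snd w *\<^sub>R F12 z)"
      "has_dderiv F2 w (\<lambda>z. fst w *\<^sub>R F21 z + snd w *\<^sub>R F22 z)"
      by (rule partials_has_dderiv[OF F1(1,3)], rule partials_has_dderiv[OF F2(1,3)])
    then show "has_dderiv (\<lambda>z. fst v *\<^sub>R F1 z + snd v *\<^sub>R F2 z) w (\<lambda>z.
       fst v *\<^sub>R (fst w *\<^sub>R F11 z + snd w *\<^sub>R F12 z) + snd v *\<^sub>R (fst w *\<^sub>R F21 z + snd w *\<^sub>R F22 z))"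
      unfolding has_dderiv_def
      by (intro allI has_vector_derivative_add bounded_linear.has_vector_derivative[OF bounded_linear_scaleR_right])
        auto
    show "fst v *\<^sub>R (fst w *\<^sub>R F11 z + snd w *\<^sub>R F12 z) + snd v *\<^sub>R (fst w *\<^sub>R F21 z + snd w *\<^sub>R F22 z)
      = fst w *\<^sub>R (fst v *\<^sub>R F11 z + snd v *\<^sub>R F12 z) + snd w *\<^sub>R (fst v *\<^sub>R F21 z + snd v *\<^sub>R F22 z)"
      by (simp add: F12 algebra_simps)
  qed (intro continuous_intros F F1 F2)+
  then show ?thesis by blast
qed

text \<open>\<open>\<iota> c\<close> is the velocity of the loop of class \<open>c\<close>.
  Disjointness makes the Gauss integrand continuous, so the iterated integral is one over the unit
  square.\<close>

lemma linking_number_torus_loops: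
  assumes F: "C2_map F dF ddF" and G: "C2_map G dG ddG" and disjoint: "\<And>x y. F x \<noteq> G y"
  defines "\<iota> \<equiv> \<lambda>c :: int \<times> int. (real_of_int (fst c), real_of_int (snd c))"
  shows "linking_number (F \<circ> torus_loop b) (G \<circ> torus_loop c) = (1 / (4 * pi)) *
     integral (cbox 0 One) (\<lambda>x::real \<times> real. gauss_form (F (fst x *\<^sub>R \<iota> b) - G (snd x *\<^sub>R \<iota> c))
        (dF (\<iota> b) (fst x *\<^sub>R \<iota> b)) (dG (\<iota> c) (snd x *\<^sub>R \<iota> c)))"
proof -
  interpret F: C2_map F dF ddF by fact
  interpret G: C2_map G dG ddG by fact
  have loop: "H \<circ> torus_loop c = (\<lambda>t. H (t *\<^sub>R \<iota> c))" for H :: "real \<times> real \<Rightarrow> real^3" and c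
    by (auto simp: torus_loop_def \<iota>_def mult.commute)
  have vF: "vector_derivative (\<lambda>t. F (t *\<^sub>R \<iota> b)) (at s) = dF (\<iota> b) (s *\<^sub>R \<iota> b)" for s
    using has_dderivD[OF F.dh[of "\<iota> b"], of 0 s UNIV] by (intro vector_derivative_at) simp
  have vG: "vector_derivative (\<lambda>t. G (t *\<^sub>R \<iota> c)) (at s) = dG (\<iota> c) (s *\<^sub>R \<iota> c)" for s
    using has_dderivD[OF G.dh[of "\<iota> c"], of 0 s UNIV] by (intro vector_derivative_at) simp
  have cont: "continuous_on S (\<lambda>x::real \<times> real. gauss_form (F (fst x *\<^sub>R \<iota> b) - G (snd x *\<^sub>R \<iota> c))
        (dF (\<iota> b) (fst x *\<^sub>R \<iota> b)) (dG (\<iota> c) (snd x *\<^sub>R \<iota> c)))" for S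
    using disjoint
    by (intro continuous_on_gauss_form continuous_on_diff continuous_on_UNIV_compose[OF F.cont_h]
        continuous_on_UNIV_compose[OF G.cont_h] continuous_on_UNIV_compose[OF F.cont_D]
        continuous_on_UNIV_compose[OF G.cont_D]) (auto intro!: continuous_intros)
  show ?thesis
    unfolding linking_number_def loop vF vG
    using integral_prod_continuous[OF cont, of 0 0 1 1]
    by (simp add: One_real_prod zero_prod_def gauss_form_def)
qed

context
  fixes F :: "real \<times> real \<Rightarrow> real^3"
  assumes emb: "smooth_torus_embedding F"
begin

lemma embedding_smooth: "smooth_map F"
  using emb by (simp add: smooth_torus_embedding_def)

lemma embedding_periodic: "periodic F"
  using emb by (auto simp: smooth_torus_embedding_def periodic_def Basis_prod_def)

lemma embedding_partials: "partials F (pd1 F) (pd2 F)"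
  using smooth_map_partials[OF embedding_smooth, of "[]"] by simp

lemma Ck_embedding: "Ck k F" and Ck_embedding_pd1: "Ck k (pd1 F)" and Ck_embedding_pd2: "Ck k (pd2 F)"
  using smooth_map_Ck[OF embedding_smooth, of k "[]"] smooth_map_Ck[OF embedding_smooth, of k "[True]"]
    smooth_map_Ck[OF embedding_smooth, of k "[False]"] by simp_all

lemma embedding_normal_nonzero: "cross3 (pd1 F z) (pd2 F z) \<noteq> 0"
  using emb unfolding smooth_torus_embedding_def by blast

lemma has_dderiv_embedding: "has_dderiv F v (\<lambda>z. fst v *\<^sub>R pd1 F z + snd v *\<^sub>R pd2 F z)"
  by (rule partials_has_dderiv[OF embedding_partials Ck_continuous[OF Ck_embedding_pd2]])

lemma Ck_torus_shift: "Ck k (torus_shift eps F)"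
proof -
  have "Ck k (\<lambda>z. F z + eps *\<^sub>R (inverse (norm (cross3 (pd1 F z) (pd2 F z))) *\<^sub>R cross3 (pd1 F z) (pd2 F z)))"
    by (intro Ck_add Ck_embedding Ck_bilinear[OF bounded_bilinear_scaleR] Ck_const Ck_inverse_norm
        Ck_bilinear[OF bounded_bilinear_cross3] Ck_embedding_pd1 Ck_embedding_pd2 embedding_normal_nonzero)
  then show ?thesis by (simp add: torus_shift_def[abs_def] unit_normal_def inverse_eq_divide)
qed

lemma periodic_torus_shift: "periodic (torus_shift eps F)"
proof -
  have "periodic (pd1 F)" "periodic (pd2 F)"
    using periodic_dderiv[OF has_dderiv_embedding[of "(1, 0)"] embedding_periodic]
      periodic_dderiv[OF has_dderiv_embedding[of "(0, 1)"] embedding_periodic] by simp_all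
  with embedding_periodic show ?thesis
    by (simp add: periodic_def torus_shift_def unit_normal_def)
qed

section \<open>An embedded torus is disjoint from its small normal shifts\<close>

text \<open>At a coincidence the displacement on the surface is normal at \<open>y\<close>, so the
  tangential term \<open>dF y\<close> is of the size of the linearisation error. The immersion
  property bounds it below by a multiple of the displacement in parameters. The resulting
  \<open>d\<close> is independent of \<open>eps\<close>.\<close>

lemma torus_shift_avoids_nearby:
  "\<exists>d>0. \<forall>y\<in>cbox 0 One. \<forall>\<delta>. \<forall>eps>0. \<bar>fst \<delta>\<bar> < d \<and> \<bar>snd \<delta>\<bar> < d \<longrightarrow> F (y + \<delta>) \<noteq> torus_shift eps F y"
proof -
  \<comment> \<open>The unit square with margin 1, so that segments of displacement below
    \<open>d \<le> 1\<close> stay inside.\<close>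
  define Q :: "(real \<times> real) set" where "Q = cbox (-1, -1) (2, 2)"
  define N where "N z = cross3 (pd1 F z) (pd2 F z)" for z
  have Q: "compact Q" "Q \<noteq> {}" unfolding Q_def by (rule compact_cbox) (simp add: cbox_Pair_eq)
  have cont: "continuous_on Q (pd1 F)" "continuous_on Q (pd2 F)"
    using continuous_on_subset[OF Ck_continuous[OF Ck_embedding_pd1]] continuous_on_subset[OF Ck_continuous[OF Ck_embedding_pd2]]
    by auto
  have "continuous_on Q (\<lambda>z. norm (N z))"
    unfolding N_def by (intro continuous_intros bounded_bilinear.continuous_on[OF bounded_bilinear_cross3] cont)
  then obtain z0 where z0: "\<forall>z\<in>Q. norm (N z0) \<le> norm (N z)"
    using continuous_attains_inf[OF Q] by blast
  define \<nu> where "\<nu> = norm (N z0)"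
  have \<nu>: "\<nu> > 0" using embedding_normal_nonzero by (simp add: \<nu>_def N_def)
  obtain z1 where z1: "\<forall>z\<in>Q. norm (pd1 F z) \<le> norm (pd1 F z1)"
    using continuous_attains_sup[OF Q continuous_on_norm[OF cont(1)]] by blast
  obtain z2 where z2: "\<forall>z\<in>Q. norm (pd2 F z) \<le> norm (pd2 F z2)"
    using continuous_attains_sup[OF Q continuous_on_norm[OF cont(2)]] by blast
  define K where "K = norm (pd1 F z1) + norm (pd2 F z2)"
  have K: "K \<ge> 0" "\<And>z. z \<in> Q \<Longrightarrow> norm (pd1 F z) \<le> K" "\<And>z. z \<in> Q \<Longrightarrow> norm (pd2 F z) \<le> K"
    unfolding K_def
    using z1[rule_format, THEN add_increasing2[OF norm_ge_zero]]
      z2[rule_format, THEN add_increasing[OF norm_ge_zero]] by auto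
  \<comment> \<open>The final estimate needs \<open>4 * K * \<eta> < \<nu>\<close>; the summand 1
    keeps the denominator positive.\<close>
  define \<eta> where "\<eta> = \<nu> / (4 * K + 1)"
  have \<eta>: "\<eta> > 0" "4 * K * \<eta> < \<nu>" using \<nu> K(1) by (simp_all add: \<eta>_def field_simps)
  obtain d1 where d1: "d1 > 0" "\<And>z z'. z \<in> Q \<Longrightarrow> z' \<in> Q \<Longrightarrow> dist z' z < d1 \<Longrightarrow> dist (pd1 F z') (pd1 F z) < \<eta>"
    using compact_uniformly_continuous[OF cont(1) Q(1)] \<eta>(1) unfolding uniformly_continuous_on_def by metis
  obtain d2 where d2: "d2 > 0" "\<And>z z'. z \<in> Q \<Longrightarrow> z' \<in> Q \<Longrightarrow> dist z' z < d2 \<Longrightarrow> dist (pd2 F z') (pd2 F z) < \<eta>"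
    using compact_uniformly_continuous[OF cont(2) Q(1)] \<eta>(1) unfolding uniformly_continuous_on_def by metis
  \<comment> \<open>The factor 1/2 accounts for bounding the norm of a displacement by the sum of
    its two coordinates.\<close>
  define d where "d = min 1 (min d1 d2 / 2)"
  have "F (y + \<delta>) \<noteq> torus_shift eps F y"
    if y: "y \<in> cbox 0 One" and eps: "eps > 0" and \<delta>: "\<bar>fst \<delta>\<bar> < d" "\<bar>snd \<delta>\<bar> < d" for y \<delta> eps
  proof
    assume eq: "F (y + \<delta>) = torus_shift eps F y"
    define \<Delta> where "\<Delta> = \<bar>fst \<delta>\<bar> + \<bar>snd \<delta>\<bar>"
    define dF where "dF z = fst \<delta> *\<^sub>R pd1 F z + snd \<delta> *\<^sub>R pd2 F z" for z
    have y': "0 \<le> fst y" "fst y \<le> 1" "0 \<le> snd y" "snd y \<le> 1"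
      using y unfolding One_real_prod zero_prod_def by (auto simp: cbox_Pair_eq mem_Times_iff)
    have yQ: "y \<in> Q" using y' by (auto simp: Q_def cbox_Pair_eq mem_Times_iff)
    have near: "y + s *\<^sub>R \<delta> \<in> Q" "dist (y + s *\<^sub>R \<delta>) y < d1" "dist (y + s *\<^sub>R \<delta>) y < d2"
      if "s \<in> {0..1}" for s
    proof -
      have s: "\<bar>s * fst \<delta>\<bar> \<le> \<bar>fst \<delta>\<bar>" "\<bar>s * snd \<delta>\<bar> \<le> \<bar>snd \<delta>\<bar>"
        using that by (auto simp: abs_mult mult_left_le_one_le)
      have "d \<le> 1" by (simp add: d_def)
      then show "y + s *\<^sub>R \<delta> \<in> Q"
        using s \<delta> y' by (auto simp: Q_def cbox_Pair_eq mem_Times_iff)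
      have "dist (y + s *\<^sub>R \<delta>) y = norm (s *\<^sub>R \<delta>)" by (simp add: dist_norm)
      also have "\<dots> \<le> \<bar>s * fst \<delta>\<bar> + \<bar>s * snd \<delta>\<bar>"
        using norm_Pair_le[of "s * fst \<delta>" "s * snd \<delta>"] by (cases \<delta>) simp
      also have "\<dots> < 2 * d" using s \<delta> by linarith
      also have "2 * d \<le> min d1 d2" unfolding d_def by linarith
      finally show "dist (y + s *\<^sub>R \<delta>) y < d1" "dist (y + s *\<^sub>R \<delta>) y < d2" by simp_all
    qed
    have "norm (F (y + 1 *\<^sub>R \<delta>) - F (y + 0 *\<^sub>R \<delta>) - (1 - 0) *\<^sub>R dF (y + 0 *\<^sub>R \<delta>)) \<le> norm (1 - 0 :: real) * (\<eta> * \<Delta>)"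
    proof (rule vector_differentiable_bound_linearization[where S = "{0..1}"])
      show "((\<lambda>s. F (y + s *\<^sub>R \<delta>)) has_vector_derivative dF (y + s *\<^sub>R \<delta>)) (at s within {0..1})" for s
        unfolding dF_def by (rule has_dderivD[OF has_dderiv_embedding])
      show "norm (dF (y + s *\<^sub>R \<delta>) - dF (y + 0 *\<^sub>R \<delta>)) \<le> \<eta> * \<Delta>" if "s \<in> {0..1}" for s
      proof -
        let ?z = "y + s *\<^sub>R \<delta>"
        have "dF ?z - dF y = fst \<delta> *\<^sub>R (pd1 F ?z - pd1 F y) + snd \<delta> *\<^sub>R (pd2 F ?z - pd2 F y)"
          by (simp add: dF_def algebra_simps)
        also have "norm \<dots> \<le> \<bar>fst \<delta>\<bar> * norm (pd1 F ?z - pd1 F y) + \<bar>snd \<delta>\<bar> * norm (pd2 F ?z - pd2 F y)"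
          by (rule order_trans[OF norm_triangle_ineq]) simp
        also have "\<dots> \<le> \<bar>fst \<delta>\<bar> * \<eta> + \<bar>snd \<delta>\<bar> * \<eta>"
          using d1(2)[OF yQ near(1)[OF that] near(2)[OF that]] d2(2)[OF yQ near(1)[OF that] near(3)[OF that]]
          by (intro add_mono mult_left_mono) (auto simp: dist_norm)
        finally show ?thesis by (simp add: \<Delta>_def algebra_simps)
      qed
    qed (auto simp: closed_segment_eq_real_ivl)
    then have err: "norm (F (y + \<delta>) - F y - dF y) \<le> \<eta> * \<Delta>" by simp
    define n where "n = unit_normal F y"
    have n: "norm n = 1" using embedding_normal_nonzero[of y] by (simp add: n_def unit_normal_def)
    have perp: "dF y \<bullet> n = 0"
      by (simp add: n_def unit_normal_def dF_def inner_add_left dot_cross_self)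
    define e where "e = F (y + \<delta>) - F y - dF y"
    have e: "eps *\<^sub>R n = dF y + e" using eq by (simp add: e_def torus_shift_def n_def)
    \<comment> \<open>The normal component of \<open>dF y + e\<close> sees only the error
      \<open>e\<close>, which therefore bounds \<open>eps\<close> and then
      \<open>dF y\<close>.\<close>
    have "eps = (eps *\<^sub>R n) \<bullet> n" using n by (simp add: norm_eq_1)
    also have "\<dots> = e \<bullet> n" unfolding e by (simp add: inner_add_left perp)
    also have "\<dots> \<le> norm e" using norm_cauchy_schwarz[of e n] n by simp
    finally have eps_le: "eps \<le> \<eta> * \<Delta>" using err by (simp add: e_def)
    have "dF y = eps *\<^sub>R n - e" using e by simp
    then have "norm (dF y) \<le> eps + norm e" using norm_triangle_ineq4[of "eps *\<^sub>R n" e] n eps by simp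
    then have dF_le: "norm (dF y) \<le> 2 * (\<eta> * \<Delta>)" using eps_le err by (simp add: e_def)
    \<comment> \<open>As in Cramer's rule, crossing with the other partial derivative isolates each
      coordinate of \<open>\<delta>\<close>.\<close>
    have "cross3 (dF y) (pd2 F y) = fst \<delta> *\<^sub>R N y" "cross3 (pd1 F y) (dF y) = snd \<delta> *\<^sub>R N y"
      by (simp_all add: dF_def N_def cross_add_left cross_add_right cross_mult_left cross_mult_right)
    then have "\<bar>fst \<delta>\<bar> * norm (N y) \<le> norm (dF y) * norm (pd2 F y)"
      "\<bar>snd \<delta>\<bar> * norm (N y) \<le> norm (pd1 F y) * norm (dF y)"
      using norm_cross3_le[of "dF y" "pd2 F y"] norm_cross3_le[of "pd1 F y" "dF y"] by simp_all
    moreover have "norm (dF y) * norm (pd2 F y) \<le> 2 * (\<eta> * \<Delta>) * K"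
      "norm (pd1 F y) * norm (dF y) \<le> 2 * (\<eta> * \<Delta>) * K"
      using mult_mono[OF dF_le K(3)[OF yQ]] mult_mono[OF K(2)[OF yQ] dF_le] K(1)
        order_trans[OF norm_ge_zero dF_le] by (simp_all add: mult.commute)
    moreover have "\<bar>fst \<delta>\<bar> * \<nu> \<le> \<bar>fst \<delta>\<bar> * norm (N y)" "\<bar>snd \<delta>\<bar> * \<nu> \<le> \<bar>snd \<delta>\<bar> * norm (N y)"
      using z0 yQ by (auto simp: \<nu>_def intro!: mult_left_mono)
    ultimately have "\<bar>fst \<delta>\<bar> * \<nu> + \<bar>snd \<delta>\<bar> * \<nu> \<le> 2 * (2 * (\<eta> * \<Delta>) * K)" by linarith
    then have le: "\<nu> * \<Delta> \<le> (4 * K * \<eta>) * \<Delta>" by (simp add: \<Delta>_def algebra_simps)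
    have "\<Delta> > 0" using eps eps_le \<eta>(1) by (metis less_le_trans zero_less_mult_pos)
    with le \<eta>(2) show False by simp
  qed
  moreover have "d > 0" using d1(1) d2(1) by (simp add: d_def)
  ultimately show ?thesis by blast
qed

text \<open>Coincidences near the diagonal are excluded by \<open>torus_shift_avoids_nearby\<close>.
  Away from it, injectivity and compactness keep points of the torus at least \<open>\<mu>\<close>
  apart, while the shift moves points by exactly \<open>eps\<close>.\<close>

lemma torus_shift_eventually_disjoint:
  "\<forall>\<^sub>F eps in at_right 0. \<forall>x y. F x \<noteq> torus_shift eps F y"
proof -
  obtain d where d: "d > 0" and near: "\<And>y \<delta> eps. y \<in> cbox 0 One \<Longrightarrow> eps > 0 \<Longrightarrow>
      \<bar>fst \<delta>\<bar> < d \<Longrightarrow> \<bar>snd \<delta>\<bar> < d \<Longrightarrow> F (y + \<delta>) \<noteq> torus_shift eps F y"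
    using torus_shift_avoids_nearby by metis
  \<comment> \<open>Pairs of a base point and a displacement reduced modulo the lattice to the
    centred square, with small displacements removed; no lattice vector remains among the
    displacements.\<close>
  define C :: "((real \<times> real) \<times> (real \<times> real)) set" where
    "C = cbox 0 One \<times> (cbox (-1/2, -1/2) (1/2, 1/2) - {-d<..<d} \<times> {-d<..<d})"
  have contF: "continuous_on S F" for S using continuous_on_subset[OF Ck_continuous[OF Ck_embedding]] by auto
  have "compact C" unfolding C_def by (intro compact_Times compact_diff compact_cbox open_Times open_greaterThanLessThan)
  moreover have "continuous_on C (\<lambda>z. norm (F (fst z + snd z) - F (fst z)))"
    by (intro continuous_intros continuous_on_UNIV_compose[OF contF])
  moreover have pos: "norm (F (fst z + snd z) - F (fst z)) > 0" if "z \<in> C" for z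
  proof -
    obtain y1 y2 a b where z: "z = ((y1, y2), (a, b))" by (metis surj_pair)
    have "F (y1 + a, y2 + b) \<noteq> F (y1, y2)"
    proof
      assume "F (y1 + a, y2 + b) = F (y1, y2)"
      then have "y1 + a - y1 \<in> \<int>" "y2 + b - y2 \<in> \<int>"
        using emb unfolding smooth_torus_embedding_def by blast+
      then obtain k l :: int where kl: "a = of_int k" "b = of_int l" by (auto elim!: Ints_cases)
      have "\<bar>a\<bar> \<le> 1/2" "\<bar>b\<bar> \<le> 1/2" using that by (auto simp: z C_def cbox_Pair_eq)
      then have "k = 0" "l = 0" unfolding kl by linarith+
      then show False using that d by (auto simp: z C_def kl)
    qed
    then show ?thesis by (simp add: z)
  qed
  \<comment> \<open>For \<open>d > 1/2\<close> the set \<open>C\<close> is empty and any positive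
    \<open>\<mu>\<close> serves; otherwise the minimum is taken.\<close>
  ultimately obtain \<mu> where \<mu>: "\<mu> > 0" "\<And>z. z \<in> C \<Longrightarrow> norm (F (fst z + snd z) - F (fst z)) \<ge> \<mu>"
  proof (cases "C = {}")
    case False
    then obtain z0 where "z0 \<in> C" "\<forall>z\<in>C. norm (F (fst z0 + snd z0) - F (fst z0)) \<le> norm (F (fst z + snd z) - F (fst z))"
      using continuous_attains_inf[OF \<open>compact C\<close> _ \<open>continuous_on C _\<close>] by blast
    then show thesis using that[of "norm (F (fst z0 + snd z0) - F (fst z0))"] pos by blast
  qed (use that[of 1] in auto)
  have "F x \<noteq> torus_shift eps F y" if eps: "0 < eps" "eps < \<mu>" for eps x y
  proof
    assume eq: "F x = torus_shift eps F y"
    define y' where "y' = (frac (fst y), frac (snd y))"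
    \<comment> \<open>Rounding moves the difference of the parameters into the centred
      square.\<close>
    define k l where "k = round (fst x - fst y)" and "l = round (snd x - snd y)"
    define \<delta> where "\<delta> = (fst x - fst y - of_int k, snd x - snd y - of_int l)"
    have B: "(1, 0) \<in> (Basis :: (real \<times> real) set)" "(0, 1) \<in> (Basis :: (real \<times> real) set)"
      by (auto simp: Basis_prod_def)
    have "x = y' + \<delta> + of_int (k + \<lfloor>fst y\<rfloor>) *\<^sub>R (1, 0) + of_int (l + \<lfloor>snd y\<rfloor>) *\<^sub>R (0, 1)"
      by (cases x; cases y) (simp add: y'_def \<delta>_def frac_def)
    then have Fx: "F x = F (y' + \<delta>)"
      using periodic_int[OF embedding_periodic B(1)] periodic_int[OF embedding_periodic B(2)] by metis
    have Gy: "torus_shift eps F y = torus_shift eps F y'"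
      unfolding y'_def by (rule periodic_frac[OF periodic_torus_shift])
    have y': "y' \<in> cbox 0 One" unfolding y'_def by (rule frac_mem_unit_square)
    show False
    proof (cases "\<bar>fst \<delta>\<bar> < d \<and> \<bar>snd \<delta>\<bar> < d")
      case True
      then show False using near[OF y' eps(1)] eq Fx Gy by auto
    next
      case False
      have "\<bar>fst \<delta>\<bar> \<le> 1/2" "\<bar>snd \<delta>\<bar> \<le> 1/2"
        using of_int_round_abs_le[of "fst x - fst y"] of_int_round_abs_le[of "snd x - snd y"]
        by (auto simp: \<delta>_def k_def l_def abs_minus_commute)
      then have "(y', \<delta>) \<in> C" using y' False
        by (cases \<delta>) (auto simp: C_def cbox_Pair_eq)
      then have "\<mu> \<le> norm (F (y' + \<delta>) - F y')" using \<mu>(2) by fastforce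
      also have "F (y' + \<delta>) - F y' = eps *\<^sub>R unit_normal F y'"
        using eq Fx Gy by (simp add: torus_shift_def)
      also have "norm \<dots> = eps" using eps embedding_normal_nonzero[of y'] by (simp add: unit_normal_def)
      finally show False using eps by simp
    qed
  qed
  then show ?thesis using \<mu>(1) unfolding eventually_at_right_field by blast
qed

end

section \<open>Singularity of Seifert forms and the counterexample\<close>

text \<open>Each matrix entry has its own range of admissible \<open>eps\<close>. Finitely many
  eventual conditions share one \<open>eps\<close>, at which \<open>linking_matrix_det\<close>
  applies to the torus and its shift.\<close>

lemma seifert_form_det:
  assumes emb: "smooth_torus_embedding F" and B: "is_seifert_form_of F B"
  shows "B (1, 0) (1, 0) * B (0, 1) (0, 1) = B (1, 0) (0, 1) * B (0, 1) (1, 0)"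
proof -
  have ev: "\<forall>\<^sub>F eps in at_right 0. linking_number (F \<circ> torus_loop b) (torus_shift eps F \<circ> torus_loop c) = real_of_int (B b c)"
    for b c using B unfolding is_seifert_form_of_def by blast
  have "\<forall>\<^sub>F eps in at_right 0.
      linking_number (F \<circ> torus_loop (1, 0)) (torus_shift eps F \<circ> torus_loop (1, 0)) = real_of_int (B (1, 0) (1, 0))
    \<and> linking_number (F \<circ> torus_loop (1, 0)) (torus_shift eps F \<circ> torus_loop (0, 1)) = real_of_int (B (1, 0) (0, 1))
    \<and> linking_number (F \<circ> torus_loop (0, 1)) (torus_shift eps F \<circ> torus_loop (1, 0)) = real_of_int (B (0, 1) (1, 0))
    \<and> linking_number (F \<circ> torus_loop (0, 1)) (torus_shift eps F \<circ> torus_loop (0, 1)) = real_of_int (B (0, 1) (0, 1))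
    \<and> (\<forall>x y. F x \<noteq> torus_shift eps F y)"
    by (intro eventually_conj ev torus_shift_eventually_disjoint emb)
  from eventually_happens'[OF trivial_limit_at_right_real this] obtain eps where lk:
      "linking_number (F \<circ> torus_loop (1, 0)) (torus_shift eps F \<circ> torus_loop (1, 0)) = real_of_int (B (1, 0) (1, 0))"
      "linking_number (F \<circ> torus_loop (1, 0)) (torus_shift eps F \<circ> torus_loop (0, 1)) = real_of_int (B (1, 0) (0, 1))"
      "linking_number (F \<circ> torus_loop (0, 1)) (torus_shift eps F \<circ> torus_loop (1, 0)) = real_of_int (B (0, 1) (1, 0))"
      "linking_number (F \<circ> torus_loop (0, 1)) (torus_shift eps F \<circ> torus_loop (0, 1)) = real_of_int (B (0, 1) (0, 1))"
    and disjoint: "\<And>x y. F x \<noteq> torus_shift eps F y"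
    by blast
  define G where "G = torus_shift eps F"
  obtain dF ddF where F: "C2_map F dF ddF" using Ck_2_imp_C2_map[OF Ck_embedding[OF emb]] by blast
  obtain dG ddG where G: "C2_map G dG ddG"
    using Ck_2_imp_C2_map[OF Ck_torus_shift[OF emb]] unfolding G_def by blast
  have perF: "periodic F" "\<And>v. periodic (dF v)"
    using embedding_periodic[OF emb] periodic_dderiv[OF C2_map.dh[OF F]] by auto
  have perG: "periodic G" "\<And>v. periodic (dG v)"
    using periodic_torus_shift[OF emb] periodic_dderiv[OF C2_map.dh[OF G]] by (auto simp: G_def)
  have disj: "\<And>x y. F x \<noteq> G y" using disjoint by (simp add: G_def)
  note lk = lk[folded G_def, unfolded linking_number_torus_loops[OF F G disj], simplified]
  have "real_of_int (B (1, 0) (1, 0)) * real_of_int (B (0, 1) (0, 1))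
      = real_of_int (B (1, 0) (0, 1)) * real_of_int (B (0, 1) (1, 0))"
    unfolding lk[symmetric]
    using linking_matrix_det[OF F perF G perG disj] by (simp add: field_simps)
  then show ?thesis by (simp flip: of_int_mult)
qed

theorem theorem4:
  shows "\<exists>B. bilinear_int B \<and> (\<forall>b c. B b c - B c b = torus_cap b c) \<and>
             (\<forall>F. smooth_torus_embedding F \<longrightarrow> \<not> is_seifert_form_of F B)"
proof -
  \<comment> \<open>The mixed term alone produces \<open>torus_cap\<close> under antisymmetrisation.
    The two symmetric terms make the matrix have rows (1, 0) and (1, 1), of determinant 1.\<close>
  define B :: "int \<times> int \<Rightarrow> int \<times> int \<Rightarrow> int" where
    "B b c = fst b * fst c + snd b * fst c + snd b * snd c" for b c
  have "bilinear_int B"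
    by (auto simp: bilinear_int_def B_def algebra_simps)
  moreover have "\<forall>b c. B b c - B c b = torus_cap b c"
    by (simp add: B_def torus_cap_def)
  moreover have "\<not> is_seifert_form_of F B" if "smooth_torus_embedding F" for F
    using seifert_form_det[OF that, of B] by (auto simp: B_def)
  ultimately show ?thesis by blast
qed

end
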